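(* Let $G$ be a $P_4$-tidy graph. Then $G$ is contact $B_0$-VPG if and only if $G$ is $\{K_5, K_{3,3}, H_0, K_4^-\}$-free.
   Context: All graphs are finite and simple. A contact $B_0$-VPG representation of a graph $G$ assigns to each vertex $v$ a path $P_v$ on a rectangular grid such that: each $P_v$ is a horizontal or a vertical path on the grid (no bends) of length at least one (it contains at least one grid-edge); no two paths share a grid-edge; no two paths cross (no grid-point is an interior point of two distinct paths); and distinct vertices $u,v$ are adjacent if and only if $P_u$ and $P_v$ have at least one grid-point in common. A graph is contact $B_0$-VPG if it has such a representation. $P_4$ is the induced path on four vertices. If $A$ is a vertex set inducing a $P_4$ in $G$, a vertex $v$ of $G$ is a partner of $A$ if $G[A\cup\{v\}]$ contains at least two induced $P_4$'s. $G$ is $P_4$-tidy if each vertex set $A$ inducing a $P_4$ in $G$ has at most one partner. $K_4^-$ is $K_4$ minus one edge. $H_0$ is the graph composed of three copies of $K_4$ sharing one common vertex, with no further edges. A graph is $\mathcal{H}$-free if no induced subgraph of it is isomorphic to a member of $\mathcal{H}$. *)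

theory Defs
  imports "Graph_Theory.Graph_Theory"
begin

text \<open>
  A finite simple graph is a loopfree symmetric digraph without parallel arcs, as described by
  the locale \<^locale>\<open>graph\<close>; \<open>u\<close> and \<open>v\<close> are adjacent in \<open>G\<close> iff \<open>u \<rightarrow>\<^bsub>G\<^esub> v\<close>. The null graph is allowed.
\<close>


section \<open>Particular graphs\<close>

definition complete_on :: "'a set \<Rightarrow> 'a pair_pre_digraph" where
  "complete_on V = \<lparr>pverts = V, parcs = {(u, v). u \<in> V \<and> v \<in> V \<and> u \<noteq> v}\<rparr>"

definition graph_K5 :: "nat pair_pre_digraph" where
  "graph_K5 = complete_on {..<5}"

definition graph_K33 :: "nat pair_pre_digraph" where
  "graph_K33 = \<lparr>pverts = {0,1,2} \<union> {3,4,5},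
     parcs = {0,1,2} \<times> {3,4,5} \<union> {3,4,5} \<times> {0,1,2}\<rparr>"

definition graph_K4_minus :: "nat pair_pre_digraph" where
  "graph_K4_minus = \<lparr>pverts = {0,1,2,3},
     parcs = parcs (complete_on {0,1,2,3}) - {(0,1), (1,0)}\<rparr>"

definition graph_H0 :: "nat pair_pre_digraph" where
  "graph_H0 = \<lparr>pverts = {0,1,2,3} \<union> {0,4,5,6} \<union> {0,7,8,9},
     parcs = parcs (complete_on {0,1,2,3}) \<union> parcs (complete_on {0,4,5,6})
       \<union> parcs (complete_on {0,7,8,9})\<rparr>"

definition graph_P4 :: "nat pair_pre_digraph" where
  "graph_P4 = \<lparr>pverts = {0,1,2,3},
     parcs = {(0,1), (1,0), (1,2), (2,1), (2,3), (3,2)}\<rparr>"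

lemma complete_digraph_graph_K5: "K\<^bsub>5\<^esub> (with_proj graph_K5)"
  by (simp add: complete_digraph_pair_def graph_K5_def complete_on_def)

lemma complete_bipartite_digraph_graph_K33: "K\<^bsub>3,3\<^esub> (with_proj graph_K33)"
  unfolding complete_bipartite_digraph_pair_def
proof (intro conjI exI)
  show "pverts graph_K33 = {0,1,2} \<union> {3,4,5}"
    by (simp add: graph_K33_def)
  show "parcs graph_K33 = {0,1,2} \<times> {3,4,5} \<union> {3,4,5} \<times> {0,1,2}"
    by (simp only: graph_K33_def pair_pre_digraph.simps)
qed (simp_all add: graph_K33_def)

lemma pair_graphI:
  assumes "finite (pverts G)" "parcs G \<subseteq> pverts G \<times> pverts G" "sym (parcs G)" "irrefl (parcs G)"
  shows "pair_graph G"
proof -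
  have "finite (parcs G)"
    using assms(1,2) finite_subset by blast
  then show ?thesis
    using assms by unfold_locales (auto simp: symmetric_def irrefl_def)
qed

lemma sym_complete_on: "sym (parcs (complete_on V))"
  and irrefl_complete_on: "irrefl (parcs (complete_on V))"
  and complete_on_subset: "parcs (complete_on V) \<subseteq> V \<times> V"
  by (auto simp: complete_on_def sym_def irrefl_def)

lemma pair_graph_graph_K4_minus: "pair_graph graph_K4_minus"
proof (rule pair_graphI)
  show "sym (parcs graph_K4_minus)"
    using sym_complete_on[of "{0,1,2,3::nat}"] by (auto simp: graph_K4_minus_def sym_def)
  show "irrefl (parcs graph_K4_minus)"
    using irrefl_complete_on[of "{0,1,2,3::nat}"] by (simp add: graph_K4_minus_def irrefl_def)
  show "parcs graph_K4_minus \<subseteq> pverts graph_K4_minus \<times> pverts graph_K4_minus"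
    using complete_on_subset[of "{0,1,2,3::nat}"] unfolding graph_K4_minus_def pair_pre_digraph.simps
    by blast
qed (simp add: graph_K4_minus_def)

lemma pair_graph_graph_H0: "pair_graph graph_H0"
proof (rule pair_graphI)
  show "sym (parcs graph_H0)"
    by (simp only: graph_H0_def pair_pre_digraph.simps sym_Un sym_complete_on)
  show "irrefl (parcs graph_H0)"
    using irrefl_complete_on[where 'a = nat] by (simp add: graph_H0_def irrefl_def)
  show "parcs graph_H0 \<subseteq> pverts graph_H0 \<times> pverts graph_H0"
    unfolding graph_H0_def pair_pre_digraph.simps
    by (intro Un_least order_trans[OF complete_on_subset] Sigma_mono) simp_all
qed (simp add: graph_H0_def)

lemma pair_graph_graph_P4: "pair_graph graph_P4"
  by (rule pair_graphI) (auto simp: graph_P4_def sym_def irrefl_def)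


section \<open>Forbidden induced subgraphs and \<open>P\<^sub>4\<close>-tidy graphs\<close>

definition free_of :: "'c pair_pre_digraph set \<Rightarrow> ('a, 'b) pre_digraph \<Rightarrow> bool" where
  "free_of \<H> G \<longleftrightarrow>
     (\<forall>H\<in>\<H>. \<not> (\<exists>F. induced_subgraph F G \<and> digraph_iso F (with_proj H)))"

definition induces_P4 :: "('a, 'b) pre_digraph \<Rightarrow> 'a set \<Rightarrow> bool" where
  "induces_P4 G A \<longleftrightarrow> A \<subseteq> verts G \<and> digraph_iso (G \<restriction> A) (with_proj graph_P4)"

text \<open>
  The induced \<open>P\<^sub>4\<close>'s of a graph are counted by their vertex sets. If \<open>A\<close> induces a \<open>P\<^sub>4\<close>, no
  \<open>v \<in> A\<close> is a partner of \<open>A\<close>, because \<open>G \<restriction> A\<close> has only four vertices.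
\<close>

definition partner :: "('a, 'b) pre_digraph \<Rightarrow> 'a set \<Rightarrow> 'a \<Rightarrow> bool" where
  "partner G A v \<longleftrightarrow> v \<in> verts G \<and>
     (\<exists>B C. B \<noteq> C \<and> induces_P4 (G \<restriction> (A \<union> {v})) B \<and> induces_P4 (G \<restriction> (A \<union> {v})) C)"

definition P4_tidy :: "('a, 'b) pre_digraph \<Rightarrow> bool" where
  "P4_tidy G \<longleftrightarrow>
     (\<forall>A. induces_P4 G A \<longrightarrow> (\<forall>v w. partner G A v \<and> partner G A w \<longrightarrow> v = w))"


section \<open>Contact \<open>B\<^sub>0\<close>-VPG representations\<close>

text \<open>
  The grid is \<open>\<int> \<times> \<int>\<close>; finitely many paths lie in a finite rectangular part of it.
  \<open>Horizontal y a b\<close> runs in row \<open>y\<close> from column \<open>a\<close> to column \<open>b\<close>, and \<open>Vertical x a b\<close> runs in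
  column \<open>x\<close> from row \<open>a\<close> to row \<open>b\<close>; the length of either is \<open>b - a\<close>.
\<close>

datatype grid_path = Horizontal int int int | Vertical int int int

fun has_positive_length :: "grid_path \<Rightarrow> bool" where
  "has_positive_length (Horizontal y a b) \<longleftrightarrow> a < b"
| "has_positive_length (Vertical x a b) \<longleftrightarrow> a < b"

fun grid_points :: "grid_path \<Rightarrow> (int \<times> int) set" where
  "grid_points (Horizontal y a b) = {(x, y) | x. a \<le> x \<and> x \<le> b}"
| "grid_points (Vertical x a b) = {(x, y) | y. a \<le> y \<and> y \<le> b}"

fun interior_points :: "grid_path \<Rightarrow> (int \<times> int) set" where
  "interior_points (Horizontal y a b) = {(x, y) | x. a < x \<and> x < b}"
| "interior_points (Vertical x a b) = {(x, y) | y. a < y \<and> y < b}"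

fun grid_edges :: "grid_path \<Rightarrow> (int \<times> int) set set" where
  "grid_edges (Horizontal y a b) = {{(x, y), (x + 1, y)} | x. a \<le> x \<and> x < b}"
| "grid_edges (Vertical x a b) = {{(x, y), (x, y + 1)} | y. a \<le> y \<and> y < b}"

definition contact_B0_VPG_representation ::
    "('a, 'b) pre_digraph \<Rightarrow> ('a \<Rightarrow> grid_path) \<Rightarrow> bool" where
  "contact_B0_VPG_representation G P \<longleftrightarrow>
     (\<forall>v \<in> verts G. has_positive_length (P v)) \<and>
     (\<forall>u \<in> verts G. \<forall>v \<in> verts G. u \<noteq> v \<longrightarrow>
        grid_edges (P u) \<inter> grid_edges (P v) = {} \<and>
        interior_points (P u) \<inter> interior_points (P v) = {} \<and>
        (u \<rightarrow>\<^bsub>G\<^esub> v \<longleftrightarrow> grid_points (P u) \<inter> grid_points (P v) \<noteq> {}))"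

definition contact_B0_VPG :: "('a, 'b) pre_digraph \<Rightarrow> bool" where
  "contact_B0_VPG G \<longleftrightarrow> (\<exists>P. contact_B0_VPG_representation G P)"

end

theory Submission
  imports Defs
begin

text \<open>
  Pairwise touching paths share a grid point, and two paths share at most one, which excludes
  \<open>K\<^sub>4\<^sup>-\<close>. Since only four grid edges meet at a point, \<open>K\<^sub>5\<close> is excluded, and a \<open>K\<^sub>4\<close> must sit at an
  endpoint of each of its paths, which excludes \<open>H\<^sub>0\<close>. The edges of an induced \<open>C\<^sub>4\<close> join
  perpendicular paths, so in \<open>K\<^sub>3\<^sub>,\<^sub>3\<close> the middle horizontal and middle vertical path would cross.

  Conversely, representations of components can be put side by side, so \<open>G\<close> may be taken connected.
  Suppose first that \<open>G\<close> has no induced \<open>P\<^sub>4\<close>. If a vertex of maximal degree is dominating, its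
  neighbourhood is a disjoint union of cliques with at most three vertices, at most two of them
  triangles by \<open>H\<^sub>0\<close>-freeness. If not, there is an induced \<open>C\<^sub>4\<close>, which forces \<open>G\<close> to be complete bipartite
  with a side of size two. Now let \<open>abcd\<close> be an induced \<open>P\<^sub>4\<close>. A vertex that is not a partner sees
  nothing of it or exactly \<open>b\<close> and \<open>c\<close>. If some vertex completes an induced \<open>P\<^sub>4\<close> to a \<open>P\<^sub>5\<close>, a \<open>C\<^sub>5\<close>, a house
  or a \<open>C\<^sub>4\<close> with a pendant edge, tidiness shows that \<open>G\<close> has just these five vertices. Otherwise the
  maximal clique \<open>Q\<close> through \<open>bc\<close>, of size at most four, has every other vertex hanging on exactly one
  of its vertices, at most two on each; the vertices of \<open>Q\<close> become the arms of a cross.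
\<close>

section \<open>Contact of grid paths\<close>

text \<open>Contact as linear inequalities: for paths of positive length, \<open>touch\<close>
  amounts to a common grid point, and \<open>compat\<close> to having neither a common grid edge nor
  a common interior point.\<close>

fun touch :: "grid_path \<Rightarrow> grid_path \<Rightarrow> bool" where
  "touch (Horizontal y a b) (Horizontal y' a' b') \<longleftrightarrow> y = y' \<and> a \<le> b' \<and> a' \<le> b"
| "touch (Vertical x a b) (Vertical x' a' b') \<longleftrightarrow> x = x' \<and> a \<le> b' \<and> a' \<le> b"
| "touch (Horizontal y a b) (Vertical x c d) \<longleftrightarrow> a \<le> x \<and> x \<le> b \<and> c \<le> y \<and> y \<le> d"
| "touch (Vertical x c d) (Horizontal y a b) \<longleftrightarrow> a \<le> x \<and> x \<le> b \<and> c \<le> y \<and> y \<le> d"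

fun compat :: "grid_path \<Rightarrow> grid_path \<Rightarrow> bool" where
  "compat (Horizontal y a b) (Horizontal y' a' b') \<longleftrightarrow> y \<noteq> y' \<or> b \<le> a' \<or> b' \<le> a"
| "compat (Vertical x a b) (Vertical x' a' b') \<longleftrightarrow> x \<noteq> x' \<or> b \<le> a' \<or> b' \<le> a"
| "compat (Horizontal y a b) (Vertical x c d) \<longleftrightarrow> \<not> (a < x \<and> x < b \<and> c < y \<and> y < d)"
| "compat (Vertical x c d) (Horizontal y a b) \<longleftrightarrow> \<not> (a < x \<and> x < b \<and> c < y \<and> y < d)"

lemma touch_iff:
  assumes "has_positive_length P" "has_positive_length Q"
  shows "touch P Q \<longleftrightarrow> grid_points P \<inter> grid_points Q \<noteq> {}"
proof
  assume t: "touch P Q"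
  show "grid_points P \<inter> grid_points Q \<noteq> {}"
  proof (cases P; cases Q)
    fix y a b y' a' b' assume *: "P = Horizontal y a b" "Q = Horizontal y' a' b'"
    then have "(max a a', y) \<in> grid_points P \<inter> grid_points Q" using t assms by auto
    then show ?thesis by blast
  next
    fix y a b y' a' b' assume *: "P = Vertical y a b" "Q = Vertical y' a' b'"
    then have "(y, max a a') \<in> grid_points P \<inter> grid_points Q" using t assms by auto
    then show ?thesis by blast
  qed (use t in auto)
next
  assume "grid_points P \<inter> grid_points Q \<noteq> {}"
  then show "touch P Q" by (cases P; cases Q) auto
qed

lemma compat_iff:
  assumes "has_positive_length P" "has_positive_length Q"
  shows "compat P Q \<longleftrightarrow>
    grid_edges P \<inter> grid_edges Q = {} \<and> interior_points P \<inter> interior_points Q = {}"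
proof
  assume "compat P Q"
  then show "grid_edges P \<inter> grid_edges Q = {} \<and> interior_points P \<inter> interior_points Q = {}"
    using assms by (cases P; cases Q) (auto simp: doubleton_eq_iff)
next
  assume r: "grid_edges P \<inter> grid_edges Q = {} \<and> interior_points P \<inter> interior_points Q = {}"
  show "compat P Q"
  proof (cases P; cases Q)
    fix y a b y' a' b' assume *: "P = Horizontal y a b" "Q = Horizontal y' a' b'"
    show ?thesis
    proof (rule ccontr)
      assume "\<not> ?thesis"
      \<comment> \<open>Collinear intervals that overlap in more than a point share the unit edge
        that starts at the larger of their left ends.\<close>
      then have "{(max a a', y), (max a a' + 1, y)} \<in> grid_edges P \<inter> grid_edges Q"
        using assms * by (simp only: Int_iff grid_edges.simps mem_Collect_eq) auto
      then show False using r by blast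
    qed
  next
    fix y a b y' a' b' assume *: "P = Vertical y a b" "Q = Vertical y' a' b'"
    show ?thesis
    proof (rule ccontr)
      assume "\<not> ?thesis"
      then have "{(y, max a a'), (y, max a a' + 1)} \<in> grid_edges P \<inter> grid_edges Q"
        using assms * by (simp only: Int_iff grid_edges.simps mem_Collect_eq) auto
      then show False using r by blast
    qed
  qed (use r in auto)
qed

text \<open>Collinear compatible paths meet at most end to end, and perpendicular lines meet only
  once.\<close>

lemma compat_unique_point:
  assumes "has_positive_length P" "has_positive_length Q" "compat P Q"
    and "p \<in> grid_points P" "p \<in> grid_points Q" "q \<in> grid_points P" "q \<in> grid_points Q"
  shows "p = q"
  using assms by (cases P; cases Q) auto

text \<open>Two of the three paths are parallel, so they lie on one line and meet end to end. A
  third path on that line could touch only one of them; a perpendicular one must contain their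
  common end.\<close>

lemma helly_three:
  assumes "has_positive_length P" "has_positive_length Q" "has_positive_length R"
    and "compat P Q" "compat P R" "compat Q R" "touch P Q" "touch P R" "touch Q R"
  shows "\<exists>p. p \<in> grid_points P \<and> p \<in> grid_points Q \<and> p \<in> grid_points R"
  using assms by (cases P; cases Q; cases R) auto

section \<open>Counting grid edges at a point\<close>

definition star :: "int \<times> int \<Rightarrow> (int \<times> int) set set" where
  "star p = {{p, (fst p + 1, snd p)}, {(fst p - 1, snd p), p}, {p, (fst p, snd p + 1)}, {(fst p, snd p - 1), p}}"

lemma finite_star: "finite (star p)" and card_star: "card (star p) \<le> 4"
  by (simp_all add: star_def card_insert_if)

fun endpoints :: "grid_path \<Rightarrow> (int \<times> int) set" where
  "endpoints (Horizontal y a b) = {(a, y), (b, y)}"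
| "endpoints (Vertical x a b) = {(x, a), (x, b)}"

lemma grid_edges_at_point:
  assumes "has_positive_length P" "p \<in> grid_points P"
  shows "grid_edges P \<inter> star p \<noteq> {}"
proof (cases P)
  case (Horizontal y a b)
  obtain x where p: "p = (x, y)" "a \<le> x" "x \<le> b" using assms Horizontal by auto
  show ?thesis
  proof (cases "x < b")
    case True
    then have "{(x, y), (x + 1, y)} \<in> grid_edges P \<inter> star p" using p Horizontal by (auto simp: star_def)
    then show ?thesis by blast
  next
    case False
    then have "a \<le> x - 1 \<and> x - 1 < b" using p assms Horizontal by auto
    \<comment> \<open>At its right end the path uses the edge to the left; \<open>x - 1 + 1\<close>
      matches the form of the edges in \<open>grid_edges\<close>.\<close>
    then have "{(x - 1, y), (x - 1 + 1, y)} \<in> grid_edges P" using Horizontal by auto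
    then have "{(x - 1, y), (x, y)} \<in> grid_edges P \<inter> star p" using p by (auto simp: star_def)
    then show ?thesis by blast
  qed
next
  case (Vertical x a b)
  obtain y where p: "p = (x, y)" "a \<le> y" "y \<le> b" using assms Vertical by auto
  show ?thesis
  proof (cases "y < b")
    case True
    then have "{(x, y), (x, y + 1)} \<in> grid_edges P \<inter> star p" using p Vertical by (auto simp: star_def)
    then show ?thesis by blast
  next
    case False
    then have "a \<le> y - 1 \<and> y - 1 < b" using p assms Vertical by auto
    then have "{(x, y - 1), (x, y - 1 + 1)} \<in> grid_edges P" using Vertical by auto
    then have "{(x, y - 1), (x, y)} \<in> grid_edges P \<inter> star p" using p by (auto simp: star_def)
    then show ?thesis by blast
  qed
qed

lemma two_grid_edges_at_interior_point:
  assumes "has_positive_length P" "p \<in> grid_points P" "p \<notin> endpoints P"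
  shows "card (grid_edges P \<inter> star p) \<ge> 2"
proof -
  have "\<exists>e f. e \<noteq> f \<and> {e, f} \<subseteq> grid_edges P \<inter> star p"
  proof (cases P)
    case (Horizontal y a b)
    obtain x where p: "p = (x, y)" "a < x" "x < b" using assms Horizontal by force
    have "{(x - 1, y), (x - 1 + 1, y)} \<in> grid_edges P"
      unfolding Horizontal grid_edges.simps mem_Collect_eq using p by (intro exI[of _ "x - 1"]) auto
    moreover have "{(x, y), (x + 1, y)} \<in> grid_edges P" using p Horizontal by auto
    ultimately show ?thesis
      by (intro exI[of _ "{(x, y), (x + 1, y)}"] exI[of _ "{(x - 1, y), (x, y)}"])
        (auto simp: star_def p doubleton_eq_iff)
  next
    case (Vertical x a b)
    obtain y where p: "p = (x, y)" "a < y" "y < b" using assms Vertical by force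
    have "{(x, y - 1), (x, y - 1 + 1)} \<in> grid_edges P"
      unfolding Vertical grid_edges.simps mem_Collect_eq using p by (intro exI[of _ "y - 1"]) auto
    moreover have "{(x, y), (x, y + 1)} \<in> grid_edges P" using p Vertical by auto
    ultimately show ?thesis
      by (intro exI[of _ "{(x, y), (x, y + 1)}"] exI[of _ "{(x, y - 1), (x, y)}"])
        (auto simp: star_def p doubleton_eq_iff)
  qed
  then obtain e f where ef: "e \<noteq> f" "{e, f} \<subseteq> grid_edges P \<inter> star p" by blast
  have "card {e, f} \<le> card (grid_edges P \<inter> star p)"
    using ef by (intro card_mono) (auto simp: finite_star)
  then show ?thesis using ef by simp
qed

text \<open>Stated for a vertex set and a relation, so that an induced subgraph is just a subset of
  \<open>V\<close> with the same \<open>E\<close>.\<close>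

definition contact_rep :: "'a set \<Rightarrow> ('a \<Rightarrow> 'a \<Rightarrow> bool) \<Rightarrow> ('a \<Rightarrow> grid_path) \<Rightarrow> bool" where
  "contact_rep V E P \<longleftrightarrow> (\<forall>v\<in>V. has_positive_length (P v)) \<and>
    (\<forall>u\<in>V. \<forall>v\<in>V. u \<noteq> v \<longrightarrow> compat (P u) (P v) \<and> (E u v \<longleftrightarrow> touch (P u) (P v)))"

lemma contact_B0_VPG_representation_iff_contact_rep:
  "contact_B0_VPG_representation G P \<longleftrightarrow> contact_rep (verts G) (\<lambda>u v. u \<rightarrow>\<^bsub>G\<^esub> v) P"
  unfolding contact_B0_VPG_representation_def contact_rep_def
  by (rule conj_cong[OF refl]) (auto simp: touch_iff compat_iff)

section \<open>Obstructions to a representation\<close>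

text \<open>Different paths share no grid edge, so the summands are the sizes of disjoint parts of
  \<open>star p\<close>.\<close>

lemma rep_sum_grid_edges_at_point:
  assumes "contact_rep V E P" "finite I" "I \<subseteq> V"
  shows "(\<Sum>v\<in>I. card (grid_edges (P v) \<inter> star p)) \<le> 4"
proof -
  have "(\<Sum>v\<in>I. card (grid_edges (P v) \<inter> star p)) = card (\<Union>v\<in>I. grid_edges (P v) \<inter> star p)"
  proof (rule card_UN_disjoint[symmetric])
    show "\<forall>i\<in>I. \<forall>j\<in>I. i \<noteq> j \<longrightarrow> grid_edges (P i) \<inter> star p \<inter> (grid_edges (P j) \<inter> star p) = {}"
    proof (intro ballI impI)
      fix i j assume "i \<in> I" "j \<in> I" "i \<noteq> j"
      then have "compat (P i) (P j)" "has_positive_length (P i)" "has_positive_length (P j)"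
        using assms unfolding contact_rep_def by auto
      then show "grid_edges (P i) \<inter> star p \<inter> (grid_edges (P j) \<inter> star p) = {}"
        using compat_iff by blast
    qed
  qed (use assms finite_star in auto)
  also have "\<dots> \<le> card (star p)" by (intro card_mono finite_star) auto
  finally show ?thesis using card_star order_trans by blast
qed

lemma rep_card_at_point:
  assumes "contact_rep V E P" "finite I" "I \<subseteq> V" "\<And>v. v \<in> I \<Longrightarrow> p \<in> grid_points (P v)"
  shows "card I \<le> 4"
proof -
  have "card I = (\<Sum>v\<in>I. 1)" by simp
  also have "\<dots> \<le> (\<Sum>v\<in>I. card (grid_edges (P v) \<inter> star p))"
  proof (rule sum_mono)
    fix v assume "v \<in> I"
    then have "grid_edges (P v) \<inter> star p \<noteq> {}"
      using assms by (intro grid_edges_at_point) (auto simp: contact_rep_def)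
    then show "1 \<le> card (grid_edges (P v) \<inter> star p)"
      using finite_star by (simp add: Suc_le_eq card_gt_0_iff)
  qed
  also have "\<dots> \<le> 4" using rep_sum_grid_edges_at_point assms by blast
  finally show ?thesis .
qed

text \<open>If \<open>p\<close> were not an end of \<open>P u\<close>, that path would use two edges
  at \<open>p\<close> and the other three at least one each, five in total.\<close>

lemma rep_endpoint_if_card_4:
  assumes "contact_rep V E P" "finite I" "I \<subseteq> V" "\<And>v. v \<in> I \<Longrightarrow> p \<in> grid_points (P v)" "card I = 4" "u \<in> I"
  shows "p \<in> endpoints (P u)"
proof (rule ccontr)
  assume "p \<notin> endpoints (P u)"
  then have u: "card (grid_edges (P u) \<inter> star p) \<ge> 2"
    using assms by (intro two_grid_edges_at_interior_point) (auto simp: contact_rep_def)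
  have "card (I - {u}) = (\<Sum>v\<in>I - {u}. 1)" by simp
  also have "\<dots> \<le> (\<Sum>v\<in>I - {u}. card (grid_edges (P v) \<inter> star p))"
  proof (rule sum_mono)
    fix v assume "v \<in> I - {u}"
    then have "grid_edges (P v) \<inter> star p \<noteq> {}"
      using assms by (intro grid_edges_at_point) (auto simp: contact_rep_def)
    then show "1 \<le> card (grid_edges (P v) \<inter> star p)"
      using finite_star by (simp add: Suc_le_eq card_gt_0_iff)
  qed
  finally have "5 \<le> (\<Sum>v\<in>I. card (grid_edges (P v) \<inter> star p))"
    using assms u by (simp add: sum.remove)
  then show False using rep_sum_grid_edges_at_point[OF assms(1-3), of p] by simp
qed

context
  fixes V :: "'a set" and E :: "'a \<Rightarrow> 'a \<Rightarrow> bool" and P :: "'a \<Rightarrow> grid_path"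
  assumes rep: "contact_rep V E P"
begin

lemma rep_pos: "v \<in> V \<Longrightarrow> has_positive_length (P v)"
  and rep_compat: "u \<in> V \<Longrightarrow> v \<in> V \<Longrightarrow> u \<noteq> v \<Longrightarrow> compat (P u) (P v)"
  and rep_touch: "u \<in> V \<Longrightarrow> v \<in> V \<Longrightarrow> u \<noteq> v \<Longrightarrow> touch (P u) (P v) \<longleftrightarrow> E u v"
  using rep by (auto simp: contact_rep_def)

lemma rep_adjI:
  assumes "u \<in> V" "v \<in> V" "u \<noteq> v" "p \<in> grid_points (P u)" "p \<in> grid_points (P v)"
  shows "E u v"
  using assms rep_touch rep_pos touch_iff by blast

lemma rep_unique_point:
  assumes "u \<in> V" "v \<in> V" "u \<noteq> v" "p \<in> grid_points (P u)" "p \<in> grid_points (P v)"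
    "q \<in> grid_points (P u)" "q \<in> grid_points (P v)"
  shows "p = q"
  using compat_unique_point[OF rep_pos rep_pos rep_compat] assms by blast

lemma rep_triangle:
  assumes "u \<in> V" "v \<in> V" "w \<in> V" "u \<noteq> v" "u \<noteq> w" "v \<noteq> w" "E u v" "E u w" "E v w"
  shows "\<exists>p. p \<in> grid_points (P u) \<and> p \<in> grid_points (P v) \<and> p \<in> grid_points (P w)"
  using assms rep_touch rep_pos rep_compat by (intro helly_three) auto

text \<open>Each of the two triangles on \<open>u\<close>, \<open>v\<close> has a common point. Both
  points lie on \<open>P u\<close> and \<open>P v\<close>, which meet only once, so
  \<open>P w\<close> and \<open>P x\<close> meet there.\<close>

lemma rep_no_diamond:
  assumes "{u, v, w, x} \<subseteq> V" "distinct [u, v, w, x]" "E u v" "E u w" "E v w" "E u x" "E v x"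
  shows "E w x"
proof -
  obtain p where p: "p \<in> grid_points (P u)" "p \<in> grid_points (P v)" "p \<in> grid_points (P w)"
    using rep_triangle[of u v w] assms by auto
  obtain q where q: "q \<in> grid_points (P u)" "q \<in> grid_points (P v)" "q \<in> grid_points (P x)"
    using rep_triangle[of u v x] assms by auto
  have "p = q" using rep_unique_point[of u v p q] p q assms by auto
  then show ?thesis using rep_adjI[of w x p] p q assms by auto
qed

text \<open>Any further vertex of \<open>K\<close> forms a triangle with \<open>a\<close> and
  \<open>b\<close>; its common point is that of \<open>a\<close>, \<open>b\<close>,
  \<open>c\<close>, because \<open>P a\<close> and \<open>P b\<close> meet only once.\<close>

lemma rep_clique_point:
  assumes "K \<subseteq> V" "\<forall>u\<in>K. \<forall>v\<in>K. u \<noteq> v \<longrightarrow> E u v" "a \<in> K" "b \<in> K" "c \<in> K" "distinct [a, b, c]"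
  shows "\<exists>p. \<forall>v\<in>K. p \<in> grid_points (P v)"
proof -
  obtain p where p: "p \<in> grid_points (P a)" "p \<in> grid_points (P b)" "p \<in> grid_points (P c)"
    using rep_triangle[of a b c] assms by auto
  have "p \<in> grid_points (P v)" if v: "v \<in> K" for v
  proof (cases "v = a \<or> v = b")
    case False
    then obtain q where q: "q \<in> grid_points (P a)" "q \<in> grid_points (P b)" "q \<in> grid_points (P v)"
      using rep_triangle[of a b v] assms v by auto
    have "p = q" using rep_unique_point[of a b p q] p q assms by auto
    then show ?thesis using q by simp
  qed (use p in auto)
  then show ?thesis by blast
qed

lemma rep_no_K5:
  assumes "{a, b, c, d, e} \<subseteq> V" "distinct [a, b, c, d, e]"
    "\<forall>u\<in>{a, b, c, d, e}. \<forall>v\<in>{a, b, c, d, e}. u \<noteq> v \<longrightarrow> E u v"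
  shows False
proof -
  obtain p where "\<forall>v\<in>{a, b, c, d, e}. p \<in> grid_points (P v)"
    using rep_clique_point[OF assms(1,3), of a b c] assms(2) by auto
  then have "card {a, b, c, d, e} \<le> 4"
    using rep_card_at_point[OF rep _ assms(1), of p] by blast
  then show False using assms(2) by auto
qed

lemma rep_K4_endpoint:
  assumes "{a, b, c, d} \<subseteq> V" "distinct [a, b, c, d]"
    "\<forall>u\<in>{a, b, c, d}. \<forall>v\<in>{a, b, c, d}. u \<noteq> v \<longrightarrow> E u v"
  shows "\<exists>p\<in>endpoints (P a). p \<in> grid_points (P b)"
proof -
  obtain p where p: "\<forall>v\<in>{a, b, c, d}. p \<in> grid_points (P v)"
    using rep_clique_point[OF assms(1,3), of a b c] assms(2) by auto
  then have "p \<in> endpoints (P a)"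
    using rep_endpoint_if_card_4[OF rep _ assms(1), of p a] assms(2) by auto
  then show ?thesis using p by blast
qed

text \<open>Each of the three cliques has its common point at an end of \<open>P v\<close>. There
  are only two ends, so two of the cliques meet at the same one.\<close>

lemma rep_no_H0:
  assumes "{v, a1, b1, c1, a2, b2, c2, a3, b3, c3} \<subseteq> V"
    "distinct [v, a1, b1, c1, a2, b2, c2, a3, b3, c3]"
    "\<forall>x\<in>{v, a1, b1, c1}. \<forall>y\<in>{v, a1, b1, c1}. x \<noteq> y \<longrightarrow> E x y"
    "\<forall>x\<in>{v, a2, b2, c2}. \<forall>y\<in>{v, a2, b2, c2}. x \<noteq> y \<longrightarrow> E x y"
    "\<forall>x\<in>{v, a3, b3, c3}. \<forall>y\<in>{v, a3, b3, c3}. x \<noteq> y \<longrightarrow> E x y"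
  shows "E a1 a2 \<or> E a1 a3 \<or> E a2 a3"
proof -
  obtain p1 where p1: "p1 \<in> endpoints (P v)" "p1 \<in> grid_points (P a1)"
    using rep_K4_endpoint[OF _ _ assms(3)] assms(1,2) by auto
  obtain p2 where p2: "p2 \<in> endpoints (P v)" "p2 \<in> grid_points (P a2)"
    using rep_K4_endpoint[OF _ _ assms(4)] assms(1,2) by auto
  obtain p3 where p3: "p3 \<in> endpoints (P v)" "p3 \<in> grid_points (P a3)"
    using rep_K4_endpoint[OF _ _ assms(5)] assms(1,2) by auto
  have "p1 = p2 \<or> p1 = p3 \<or> p2 = p3"
    using p1 p2 p3 by (cases "P v") auto
  then show ?thesis
    using rep_adjI[of a1 a2 p1] rep_adjI[of a1 a3 p1] rep_adjI[of a2 a3 p2] p1 p2 p3 assms(1,2) by auto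
qed

end

section \<open>Directions of paths in induced squares, and the exclusion of
  \<open>K33\<close>\<close>

fun horizontal :: "grid_path \<Rightarrow> bool" where
  "horizontal (Horizontal y a b) = True"
| "horizontal (Vertical x a b) = False"

text \<open>Reflection in the diagonal; it reduces two vertical paths to two horizontal
  ones.\<close>

fun flip :: "grid_path \<Rightarrow> grid_path" where
  "flip (Horizontal y a b) = Vertical y a b"
| "flip (Vertical x a b) = Horizontal x a b"

lemma flip_simps [simp]:
  "has_positive_length (flip p) = has_positive_length p" "horizontal (flip p) = (\<not> horizontal p)"
  "touch (flip p) (flip q) = touch p q" "compat (flip p) (flip q) = compat p q"
  by (cases p; cases q; auto)+

fun leftmost :: "grid_path \<Rightarrow> int" where
  "leftmost (Horizontal y a b) = a"
| "leftmost (Vertical x a b) = x"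

fun rightmost :: "grid_path \<Rightarrow> int" where
  "rightmost (Horizontal y a b) = b"
| "rightmost (Vertical x a b) = x"

lemma touch_leftmost: "touch p q \<Longrightarrow> leftmost p \<le> rightmost q"
  by (cases p; cases q) auto

lemma touch_commute: "touch p q \<longleftrightarrow> touch q p" and compat_commute: "compat p q \<longleftrightarrow> compat q p"
  by (cases p; cases q; auto)+

text \<open>\<open>q\<close> continues \<open>p\<close> to the right. Since \<open>r\<close> misses
  \<open>p\<close>, it misses their common end: a vertical \<open>r\<close> meets \<open>q\<close>
  further right, and a horizontal one is attached at the right end of \<open>q\<close>.\<close>

lemma leftmost_beyond:
  assumes "horizontal p" "horizontal q" "has_positive_length r" "rightmost p = leftmost q"
    "touch p q" "touch q r" "\<not> touch p r" "compat q r" "has_positive_length q" "has_positive_length p"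
  shows "rightmost p < leftmost r"
  using assms by (cases p; cases q; cases r) auto

lemma rightmost_before:
  assumes "horizontal p" "horizontal q" "has_positive_length r" "rightmost p = leftmost q"
    "touch p q" "touch p r" "\<not> touch q r" "compat p r" "has_positive_length p" "has_positive_length q"
  shows "rightmost r < leftmost q"
  using assms by (cases p; cases q; cases r) auto

text \<open>If \<open>a\<close> and \<open>b\<close> are collinear, their common end separates the
  other two paths: \<open>c\<close>, which touches \<open>b\<close>, lies strictly on one side of it
  and \<open>d\<close>, which touches \<open>a\<close>, strictly on the other.\<close>

lemma no_horizontal_square:
  assumes "horizontal a" "horizontal b"
    "has_positive_length a" "has_positive_length b" "has_positive_length c" "has_positive_length d"
    "compat a b" "compat b c" "compat a d"
    "touch a b" "touch b c" "touch c d" "touch a d" "\<not> touch a c" "\<not> touch b d"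
  shows False
proof -
  have "rightmost a = leftmost b \<or> rightmost b = leftmost a"
    using assms(1-4,7,10) by (cases a; cases b) auto
  then show False
  proof
    assume *: "rightmost a = leftmost b"
    have "rightmost a < leftmost c" using leftmost_beyond[of a b c] assms * by blast
    moreover have "rightmost d < leftmost b" using rightmost_before[of a b d] assms * by blast
    ultimately show False using touch_leftmost[OF assms(12)] * by simp
  next
    assume *: "rightmost b = leftmost a"
    have "rightmost b < leftmost d"
      using leftmost_beyond[of b a d] assms * touch_commute[of a b] by blast
    moreover have "rightmost c < leftmost a"
      using rightmost_before[of b a c] assms * touch_commute[of a b] by blast
    ultimately show False using touch_leftmost[of d c] assms(12) touch_commute[of c d] * by simp
  qed
qed

lemma contact_square_perpendicular:
  assumes "has_positive_length a" "has_positive_length b" "has_positive_length c" "has_positive_length d"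
    "compat a b" "compat b c" "compat a d"
    "touch a b" "touch b c" "touch c d" "touch a d" "\<not> touch a c" "\<not> touch b d"
  shows "horizontal a \<noteq> horizontal b"
  using no_horizontal_square[of a b c d] no_horizontal_square[of "flip a" "flip b" "flip c" "flip d"]
    assms by auto

lemma middle_of_three:
  fixes f :: "'b \<Rightarrow> int"
  assumes "f a \<noteq> f b" "f a \<noteq> f c" "f b \<noteq> f c"
  obtains l m u where "{l, m, u} = {a, b, c}" "f l < f m" "f m < f u"
proof -
  have "{b, a, c} = {a, b, c}" "{a, c, b} = {a, b, c}" "{b, c, a} = {a, b, c}" "{c, a, b} = {a, b, c}"
    "{c, b, a} = {a, b, c}" by auto
  then show thesis
    using that[of a b c] that[of b a c] that[of a c b] that[of b c a] that[of c a b] that[of c b a] assms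
    by (metis linorder_neqE)
qed

fun level :: "grid_path \<Rightarrow> int" where
  "level (Horizontal y a b) = y"
| "level (Vertical x a b) = x"

text \<open>Were both paths in one row, the vertical path \<open>r\<close> would meet them at the
  same point of that row.\<close>

lemma level_touch_perpendicular:
  assumes "horizontal p" "horizontal q" "\<not> touch p q" "\<not> horizontal r" "touch p r" "touch q r"
  shows "level p \<noteq> level q"
  using assms by (cases p; cases q; cases r) auto

lemma level_touch_perpendicular':
  assumes "\<not> horizontal p" "\<not> horizontal q" "\<not> touch p q" "horizontal r" "touch p r" "touch q r"
  shows "level p \<noteq> level q"
  using assms by (cases p; cases q; cases r) auto

text \<open>\<open>m\<close> reaches the columns of \<open>l'\<close> and \<open>u'\<close>, which
  lie on either side of that of \<open>m'\<close>; likewise \<open>m'\<close> reaches the rows of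
  \<open>l\<close> and \<open>u\<close>. So their common point is interior to both.\<close>

lemma middle_paths_cross:
  assumes "horizontal l" "horizontal m" "horizontal u" "\<not> horizontal l'" "\<not> horizontal m'" "\<not> horizontal u'"
    and "level l < level m" "level m < level u" "level l' < level m'" "level m' < level u'"
    and "touch m l'" "touch m u'" "touch l m'" "touch u m'"
  shows "\<not> compat m m'"
  using assms by (cases l; cases m; cases u; cases l'; cases m'; cases u') auto

lemma no_perpendicular_K33:
  assumes h: "horizontal a" "horizontal b" "horizontal c"
    and v: "\<not> horizontal d" "\<not> horizontal e" "\<not> horizontal f"
    and t: "\<forall>p\<in>{a, b, c}. \<forall>q\<in>{d, e, f}. compat p q \<and> touch p q"
    and "\<not> touch a b" "\<not> touch a c" "\<not> touch b c" "\<not> touch d e" "\<not> touch d f" "\<not> touch e f"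
  shows False
proof -
  have "level a \<noteq> level b" "level a \<noteq> level c" "level b \<noteq> level c"
    using level_touch_perpendicular[of _ _ d] assms by auto
  then obtain l m u where 1: "{l, m, u} = {a, b, c}" "level l < level m" "level m < level u"
    by (rule middle_of_three)
  have "level d \<noteq> level e" "level d \<noteq> level f" "level e \<noteq> level f"
    using level_touch_perpendicular'[of _ _ a] assms touch_commute by auto
  then obtain l' m' u' where 2: "{l', m', u'} = {d, e, f}" "level l' < level m'" "level m' < level u'"
    by (rule middle_of_three)
  have m1: "l \<in> {a, b, c}" "m \<in> {a, b, c}" "u \<in> {a, b, c}" using 1(1) by blast+
  have m2: "l' \<in> {d, e, f}" "m' \<in> {d, e, f}" "u' \<in> {d, e, f}" using 2(1) by blast+
  have "horizontal l" "horizontal m" "horizontal u" using m1 h by auto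
  moreover have "\<not> horizontal l'" "\<not> horizontal m'" "\<not> horizontal u'" using m2 v by auto
  moreover have "touch m l'" "touch m u'" "touch l m'" "touch u m'" 
    using t[THEN bspec, THEN bspec] m1 m2 by simp_all
  ultimately have "\<not> compat m m'"
    using 1(2,3) 2(2,3) by (intro middle_paths_cross[of l m u l' m' u'])
  then show False using t m1 m2 by blast
qed

lemma rep_no_K33:
  assumes rep: "contact_rep V E P" and V: "{a, b, c, d, e, f} \<subseteq> V" and dist: "distinct [a, b, c, d, e, f]"
    and bip: "\<forall>x\<in>{a, b, c}. \<forall>y\<in>{d, e, f}. E x y"
    and ind: "\<forall>x\<in>{a, b, c}. \<forall>y\<in>{a, b, c}. \<not> E x y" "\<forall>x\<in>{d, e, f}. \<forall>y\<in>{d, e, f}. \<not> E x y"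
  shows False
proof -
  have t: "compat (P x) (P y) \<and> touch (P x) (P y)" if "x \<in> {a, b, c}" "y \<in> {d, e, f}" for x y
  proof -
    have "x \<in> V" "y \<in> V" "x \<noteq> y" "E x y" using that V dist bip by auto
    then show ?thesis using rep unfolding contact_rep_def by blast
  qed
  have n: "\<not> touch (P x) (P y) \<and> compat (P x) (P y)"
    if "x \<in> {a, b, c} \<and> y \<in> {a, b, c} \<or> x \<in> {d, e, f} \<and> y \<in> {d, e, f}" "x \<noteq> y" for x y
  proof -
    have "x \<in> V" "y \<in> V" "\<not> E x y" using that V ind by auto
    then show ?thesis using rep that(2) unfolding contact_rep_def by blast
  qed
  have p: "has_positive_length (P x)" if "x \<in> {a, b, c, d, e, f}" for x
    using rep V that unfolding contact_rep_def by auto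
  \<comment> \<open>One more vertex from each side completes \<open>x\<close> and \<open>y\<close>
    to an induced four-cycle, in which adjacent paths are perpendicular.\<close>
  have sq: "horizontal (P x) \<noteq> horizontal (P y)"
    if "x \<in> {a, b, c}" "y \<in> {d, e, f}" for x y
  proof -
    obtain x' where x': "x' \<in> {a, b, c}" "x' \<noteq> x" using dist by auto
    obtain y' where y': "y' \<in> {d, e, f}" "y' \<noteq> y" using dist by auto
    show ?thesis
      using contact_square_perpendicular[of "P x" "P y" "P x'" "P y'"]
        t[of x y] t[of x y'] t[of x' y] t[of x' y'] n[of x x'] n[of y y'] p[of x] p[of y] p[of x'] p[of y']
        x' y' that touch_commute compat_commute
      by (metis insert_iff empty_iff)
  qed
  have D: "a \<noteq> b" "a \<noteq> c" "b \<noteq> c" "d \<noteq> e" "d \<noteq> f" "e \<noteq> f" using dist by auto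
  have N: "\<not> touch (P a) (P b)" "\<not> touch (P a) (P c)" "\<not> touch (P b) (P c)"
    "\<not> touch (P d) (P e)" "\<not> touch (P d) (P f)" "\<not> touch (P e) (P f)"
    using n D by auto
  \<comment> \<open>The direction of \<open>P a\<close> fixes the directions of all six paths; if it
    is vertical, the two sides exchange roles.\<close>
  show False
  proof (cases "horizontal (P a)")
    case True
    then have "\<not> horizontal (P d)" "\<not> horizontal (P e)" "\<not> horizontal (P f)" using sq[of a] by auto
    moreover from this have "horizontal (P b)" "horizontal (P c)" using sq[of _ d] by auto
    ultimately show False
      using no_perpendicular_K33[of "P a" "P b" "P c" "P d" "P e" "P f"] True N t by auto
  next
    case False
    then have "horizontal (P d)" "horizontal (P e)" "horizontal (P f)" using sq[of a] by auto
    moreover from this have "\<not> horizontal (P b)" "\<not> horizontal (P c)" using sq[of _ d] by auto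
    ultimately show False
      using no_perpendicular_K33[of "P d" "P e" "P f" "P a" "P b" "P c"] False N t
        touch_commute compat_commute by auto
  qed
qed

section \<open>Induced subgraphs as embeddings\<close>

text \<open>An induced copy of \<open>H\<close> given by its labelling \<open>h\<close>, a form
  without subgraphs and arcs of the host graph.\<close>

definition embeds :: "'c pair_pre_digraph \<Rightarrow> 'a set \<Rightarrow> ('a \<Rightarrow> 'a \<Rightarrow> bool) \<Rightarrow> bool" where
  "embeds H V E \<longleftrightarrow> (\<exists>h. inj_on h (pverts H) \<and> h ` pverts H \<subseteq> V \<and>
     (\<forall>i\<in>pverts H. \<forall>j\<in>pverts H. E (h i) (h j) \<longleftrightarrow> (i, j) \<in> parcs H))"

lemma adj_induced_subgraph:
  assumes "induced_subgraph F G" "u \<in> verts F" "v \<in> verts F"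
  shows "u \<rightarrow>\<^bsub>F\<^esub> v \<longleftrightarrow> u \<rightarrow>\<^bsub>G\<^esub> v"
  using assms
  by (auto simp: arcs_ends_conv induced_subgraph_def subgraph_def compatible_tail compatible_head image_iff)

lemma embeds_if_iso:
  assumes "induced_subgraph F G" "digraph_iso F (with_proj H)"
  shows "embeds H (verts G) (\<lambda>u v. u \<rightarrow>\<^bsub>G\<^esub> v)"
proof -
  have wf: "wf_digraph F" using assms(1) wf_digraphI_induced by blast
  obtain f where f: "pre_digraph.digraph_isomorphism F f" "with_proj H = app_iso f F"
    using assms(2) unfolding digraph_iso_def by blast
  let ?g = "iso_verts f"
  have V: "pverts H = ?g ` verts F" using f(2) by (metis verts_app_iso with_proj_simps(1))
  have inj: "inj_on ?g (verts F)" using f(1) by (simp add: pre_digraph.digraph_isomorphism_def)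
  have A: "parcs H = arcs_ends (app_iso f F)" using f(2) by (metis with_proj_simps(3))
  have "arcs_ends (app_iso f F) = (\<lambda>e. (?g (tail F e), ?g (head F e))) ` arcs F"
    using f(1) by (auto simp: arcs_ends_conv pre_digraph.digraph_isomorphism_def image_iff)
  then have A: "parcs H = (\<lambda>e. (?g (tail F e), ?g (head F e))) ` arcs F" using A by simp
  have adj: "(?g u, ?g v) \<in> parcs H \<longleftrightarrow> u \<rightarrow>\<^bsub>F\<^esub> v" if "u \<in> verts F" "v \<in> verts F" for u v
    using that inj wf unfolding A arcs_ends_conv
    by (auto simp: image_iff inj_on_eq_iff wf_digraph.tail_in_verts wf_digraph.head_in_verts
        intro!: bexI)
  let ?h = "the_inv_into (verts F) ?g"
  have h: "?h i \<in> verts F" "?g (?h i) = i" if "i \<in> pverts H" for i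
    using that inj V the_inv_into_into[OF inj, of i "verts F"] f_the_inv_into_f[OF inj, of i] by auto
  have FG: "verts F \<subseteq> verts G" using assms(1) by (auto simp: induced_subgraph_def)
  show ?thesis unfolding embeds_def
  proof (intro exI conjI ballI)
    show "inj_on ?h (pverts H)" by (metis h(2) inj_onI)
    show "?h ` pverts H \<subseteq> verts G" using h FG by auto
    fix i j assume "i \<in> pverts H" "j \<in> pverts H"
    then show "?h i \<rightarrow>\<^bsub>G\<^esub> ?h j \<longleftrightarrow> (i, j) \<in> parcs H"
      using adj[of "?h i" "?h j"] adj_induced_subgraph[OF assms(1)] h by simp
  qed
qed

lemma iso_if_embedding:
  assumes G: "wf_digraph G" "nomulti_digraph G"
    and inj: "inj_on h (pverts H)" and V: "h ` pverts H \<subseteq> verts G"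
    and adj: "\<forall>i\<in>pverts H. \<forall>j\<in>pverts H. h i \<rightarrow>\<^bsub>G\<^esub> h j \<longleftrightarrow> (i, j) \<in> parcs H"
    and H: "parcs H \<subseteq> pverts H \<times> pverts H"
  shows "digraph_iso (G \<restriction> (h ` pverts H)) (with_proj H)"
proof -
  let ?F = "G \<restriction> (h ` pverts H)"
  let ?g = "the_inv_into (pverts H) h"
  \<comment> \<open>A vertex is sent to its label and an arc to the labels of its ends; the latter
    is injective because there are no parallel arcs.\<close>
  let ?f = "\<lparr>iso_verts = ?g, iso_arcs = (\<lambda>e. (?g (tail G e), ?g (head G e))),
    iso_head = snd, iso_tail = fst\<rparr>"
  have g: "?g (h i) = i" if "i \<in> pverts H" for i using inj that by (simp add: the_inv_into_f_f)
  have "induced_subgraph ?F G" using G(1) V by (simp add: wf_digraph.induced_induce)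
  then have wf: "wf_digraph ?F" by (rule wf_digraphI_induced)
  have iso: "pre_digraph.digraph_isomorphism ?F ?f"
    unfolding pre_digraph.digraph_isomorphism_def
  proof (intro conjI wf)
    show inj': "inj_on (iso_verts ?f) (verts ?F)"
      using inj by (auto simp: inj_on_def the_inv_into_f_f)
    show "inj_on (iso_arcs ?f) (arcs ?F)"
    proof (rule inj_onI)
      fix e e' assume e: "e \<in> arcs ?F" "e' \<in> arcs ?F" "iso_arcs ?f e = iso_arcs ?f e'"
      then have "tail G e = tail G e' \<and> head G e = head G e'"
        using inj' by (auto simp: induce_subgraph_def inj_on_eq_iff)
      then show "e = e'" using e nomulti_digraph.no_multi_arcs[OF G(2)]
        by (auto simp: induce_subgraph_def arc_to_ends_def)
    qed
  qed (auto simp: induce_subgraph_def)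
  have "with_proj H = app_iso ?f ?F"
  proof (rule pre_digraph.equality)
    show "verts (with_proj H) = verts (app_iso ?f ?F)"
      using g by (auto simp: image_iff)
    show "arcs (with_proj H) = arcs (app_iso ?f ?F)"
    proof (intro set_eqI iffI)
      fix ij assume ij: "ij \<in> arcs (with_proj H)"
      obtain i j where e: "ij = (i, j)" by (cases ij)
      have ij: "(i, j) \<in> parcs H" "i \<in> pverts H" "j \<in> pverts H" using ij e H by auto
      then have "h i \<rightarrow>\<^bsub>G\<^esub> h j" using adj by blast
      then obtain e where "e \<in> arcs G" "tail G e = h i" "head G e = h j" by auto
      then show "ij \<in> arcs (app_iso ?f ?F)"
        using ij g \<open>ij = (i, j)\<close> by (auto simp: induce_subgraph_def image_iff intro!: bexI[of _ e])
    next
      fix ij assume "ij \<in> arcs (app_iso ?f ?F)"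
      then obtain e i j where e: "e \<in> arcs G" "i \<in> pverts H" "tail G e = h i" "j \<in> pverts H" "head G e = h j"
        "ij = (?g (h i), ?g (h j))"
        by (auto simp: induce_subgraph_def image_iff)
      then have "h i \<rightarrow>\<^bsub>G\<^esub> h j" by (force simp: arcs_ends_conv)
      then show "ij \<in> arcs (with_proj H)" using e g adj by simp
    qed
  qed auto
  then show ?thesis using iso unfolding digraph_iso_def by blast
qed

lemma free_of_iff_not_embeds:
  assumes "graph G" "\<And>H. H \<in> \<H> \<Longrightarrow> parcs H \<subseteq> pverts H \<times> pverts H"
  shows "free_of \<H> G \<longleftrightarrow> (\<forall>H\<in>\<H>. \<not> embeds H (verts G) (\<lambda>u v. u \<rightarrow>\<^bsub>G\<^esub> v))"
proof -
  interpret graph G by fact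
  have "(\<exists>F. induced_subgraph F G \<and> digraph_iso F (with_proj H)) \<longleftrightarrow>
      embeds H (verts G) (\<lambda>u v. u \<rightarrow>\<^bsub>G\<^esub> v)" if "H \<in> \<H>" for H
  proof
    assume "embeds H (verts G) (\<lambda>u v. u \<rightarrow>\<^bsub>G\<^esub> v)"
    then obtain h where h: "inj_on h (pverts H)" "h ` pverts H \<subseteq> verts G"
      "\<forall>i\<in>pverts H. \<forall>j\<in>pverts H. h i \<rightarrow>\<^bsub>G\<^esub> h j \<longleftrightarrow> (i, j) \<in> parcs H"
      unfolding embeds_def by blast
    have "digraph_iso (G \<restriction> (h ` pverts H)) (with_proj H)"
      using iso_if_embedding[OF wf_digraph nomulti_digraph h] assms(2)[OF that] by blast
    moreover have "induced_subgraph (G \<restriction> (h ` pverts H)) G"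
      using h by (simp add: induced_induce)
    ultimately show "\<exists>F. induced_subgraph F G \<and> digraph_iso F (with_proj H)" by blast
  qed (use embeds_if_iso in blast)
  then show ?thesis unfolding free_of_def by blast
qed

text \<open>All graphs to be embedded have an initial segment of the naturals as vertex set, so an
  induced copy can be given as a list.\<close>

lemma embedsI_list:
  assumes "distinct xs" "set xs \<subseteq> V" "pverts H = {..<length xs}"
    and "\<And>i j. i < length xs \<Longrightarrow> j < length xs \<Longrightarrow> E (xs ! i) (xs ! j) \<longleftrightarrow> (i, j) \<in> parcs H"
  shows "embeds H V E"
  unfolding embeds_def
proof (intro exI conjI)
  show "inj_on ((!) xs) (pverts H)" using assms(1,3) by (simp add: inj_on_nth)
  show "(!) xs ` pverts H \<subseteq> V" using assms(2,3) nth_mem by fastforce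
qed (use assms in auto)

lemma embedsE_list:
  assumes "embeds H V E" "pverts H = {..<n}"
  obtains xs where "length xs = n" "distinct xs" "set xs \<subseteq> V"
    "\<And>i j. i < n \<Longrightarrow> j < n \<Longrightarrow> E (xs ! i) (xs ! j) \<longleftrightarrow> (i, j) \<in> parcs H"
proof -
  obtain h where h: "inj_on h {..<n}" "h ` {..<n} \<subseteq> V"
    "\<forall>i<n. \<forall>j<n. E (h i) (h j) \<longleftrightarrow> (i, j) \<in> parcs H"
    using assms unfolding embeds_def by auto
  show thesis
    by (rule that[of "map h [0..<n]"]) (use h in \<open>auto simp: distinct_map atLeast0LessThan\<close>)
qed

lemma pverts_graphs:
  "pverts graph_K5 = {..<5}" "pverts graph_K33 = {..<6}" "pverts graph_H0 = {..<10}"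
  "pverts graph_K4_minus = {..<4}" "pverts graph_P4 = {..<4}"
  by (auto simp: graph_K5_def graph_K33_def graph_H0_def graph_K4_minus_def graph_P4_def complete_on_def)

section \<open>Represented graphs avoid the forbidden subgraphs\<close>

context
  fixes V :: "'a set" and E :: "'a \<Rightarrow> 'a \<Rightarrow> bool" and P :: "'a \<Rightarrow> grid_path"
  assumes rep: "contact_rep V E P"
begin

lemma rep_not_embeds_K5: "\<not> embeds graph_K5 V E"
proof
  assume "embeds graph_K5 V E"
  then obtain xs where xs: "length xs = 5" "distinct xs" "set xs \<subseteq> V"
    "\<And>i j. i < 5 \<Longrightarrow> j < 5 \<Longrightarrow> E (xs ! i) (xs ! j) \<longleftrightarrow> (i, j) \<in> parcs graph_K5"
    by (rule embedsE_list[OF _ pverts_graphs(1)]) blast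
  show False
    by (rule rep_no_K5[OF rep, of "xs ! 0" "xs ! 1" "xs ! 2" "xs ! 3" "xs ! 4"])
      (use xs in \<open>auto simp: graph_K5_def complete_on_def nth_eq_iff_index_eq subset_iff\<close>)
qed

lemma rep_not_embeds_K4_minus: "\<not> embeds graph_K4_minus V E"
proof
  assume "embeds graph_K4_minus V E"
  then obtain xs where xs: "length xs = 4" "distinct xs" "set xs \<subseteq> V"
    "\<And>i j. i < 4 \<Longrightarrow> j < 4 \<Longrightarrow> E (xs ! i) (xs ! j) \<longleftrightarrow> (i, j) \<in> parcs graph_K4_minus"
    by (rule embedsE_list[OF _ pverts_graphs(4)]) blast
  \<comment> \<open>Labels 2 and 3 are the ends of the edge in both triangles; 0 and 1 are the ends
    of the missing edge.\<close>
  have "E (xs ! 0) (xs ! 1)"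
    by (rule rep_no_diamond[OF rep, of "xs ! 2" "xs ! 3" "xs ! 0" "xs ! 1"])
      (use xs in \<open>auto simp: graph_K4_minus_def complete_on_def nth_eq_iff_index_eq subset_iff\<close>)
  then show False using xs by (auto simp: graph_K4_minus_def)
qed

lemma rep_not_embeds_K33: "\<not> embeds graph_K33 V E"
proof
  assume "embeds graph_K33 V E"
  then obtain xs where xs: "length xs = 6" "distinct xs" "set xs \<subseteq> V"
    "\<And>i j. i < 6 \<Longrightarrow> j < 6 \<Longrightarrow> E (xs ! i) (xs ! j) \<longleftrightarrow> (i, j) \<in> parcs graph_K33"
    by (rule embedsE_list[OF _ pverts_graphs(2)]) blast
  show False
    by (rule rep_no_K33[OF rep, of "xs ! 0" "xs ! 1" "xs ! 2" "xs ! 3" "xs ! 4" "xs ! 5"])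
      (use xs in \<open>auto simp: graph_K33_def nth_eq_iff_index_eq subset_iff\<close>)
qed

lemma rep_not_embeds_H0: "\<not> embeds graph_H0 V E"
proof
  assume "embeds graph_H0 V E"
  then obtain xs where xs: "length xs = 10" "distinct xs" "set xs \<subseteq> V"
    "\<And>i j. i < 10 \<Longrightarrow> j < 10 \<Longrightarrow> E (xs ! i) (xs ! j) \<longleftrightarrow> (i, j) \<in> parcs graph_H0"
    by (rule embedsE_list[OF _ pverts_graphs(3)]) blast
  have E: "E (xs ! i) (xs ! j) \<longleftrightarrow> i \<noteq> j \<and>
      ({i, j} \<subseteq> {0, 1, 2, 3} \<or> {i, j} \<subseteq> {0, 4, 5, 6} \<or> {i, j} \<subseteq> {0, 7, 8, 9})" if "i < 10" "j < 10" for i j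
    using xs(4)[OF that] by (auto simp: graph_H0_def complete_on_def)
  have "E (xs ! 1) (xs ! 4) \<or> E (xs ! 1) (xs ! 7) \<or> E (xs ! 4) (xs ! 7)"
    by (rule rep_no_H0[OF rep, of "xs ! 0" "xs ! 1" "xs ! 2" "xs ! 3" "xs ! 4" "xs ! 5" "xs ! 6" "xs ! 7" "xs ! 8" "xs ! 9"])
      (use xs(1-3) in \<open>simp_all add: E nth_eq_iff_index_eq subset_iff\<close>)
  then show False by (simp add: E)
qed

end


section \<open>Forbidden subgraphs obtained from vertex sets\<close>

lemma embeds_K5I:
  assumes "K \<subseteq> V" "finite K" "card K \<ge> 5" "\<forall>u\<in>K. \<forall>v\<in>K. u \<noteq> v \<longleftrightarrow> E u v"
  shows "embeds graph_K5 V E"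
proof -
  obtain K' where "K' \<subseteq> K" "card K' = 5" "finite K'" using assms by (metis obtain_subset_with_card_n)
  then obtain xs where xs: "set xs \<subseteq> K" "distinct xs" "length xs = 5"
    by (metis finite_distinct_list distinct_card)
  show ?thesis
  proof (rule embedsI_list[OF xs(2)])
    fix i j assume ij: "i < length xs" "j < length xs"
    then have "xs ! i \<in> K" "xs ! j \<in> K" using xs(1) nth_mem by blast+
    then have "E (xs ! i) (xs ! j) \<longleftrightarrow> xs ! i \<noteq> xs ! j" using assms(4) by blast
    then show "E (xs ! i) (xs ! j) \<longleftrightarrow> (i, j) \<in> parcs graph_K5"
      using nth_eq_iff_index_eq[OF xs(2) ij] ij xs(3) by (simp add: graph_K5_def complete_on_def)
  qed (use xs assms in \<open>auto simp: pverts_graphs\<close>)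
qed

lemma embeds_K33I:
  assumes "X \<subseteq> V" "finite X" "card X \<ge> 3" "Y \<subseteq> V" "finite Y" "card Y \<ge> 3" "X \<inter> Y = {}"
    "\<forall>u\<in>X. \<forall>v\<in>X. \<not> E u v" "\<forall>u\<in>Y. \<forall>v\<in>Y. \<not> E u v" "\<forall>u\<in>X. \<forall>v\<in>Y. E u v \<and> E v u"
  shows "embeds graph_K33 V E"
proof -
  obtain X' where X': "X' \<subseteq> X" "card X' = 3" using assms by (metis obtain_subset_with_card_n)
  obtain Y' where Y': "Y' \<subseteq> Y" "card Y' = 3" using assms by (metis obtain_subset_with_card_n)
  obtain a b c where X: "X' = {a, b, c}" "a \<noteq> b" "a \<noteq> c" "b \<noteq> c" using X'(2) unfolding card_3_iff by blast
  obtain d e f where Y: "Y' = {d, e, f}" "d \<noteq> e" "d \<noteq> f" "e \<noteq> f" using Y'(2) unfolding card_3_iff by blast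
  have in': "a \<in> X" "b \<in> X" "c \<in> X" "d \<in> Y" "e \<in> Y" "f \<in> Y" using X X' Y Y' by auto
  let ?xs = "[a, b, c, d, e, f]"
  \<comment> \<open>Adjacency depends only on the sides of the two vertices, so translating sides
    into index ranges avoids a check of all 36 pairs.\<close>
  have *: "?xs ! i \<in> X \<longleftrightarrow> i \<in> {0, 1, 2}" "?xs ! i \<in> Y \<longleftrightarrow> i \<in> {3, 4, 5}"
    "i \<in> {0, 1, 2} \<or> i \<in> {3, 4, 5}" if "i < 6" for i
  proof -
    have "i = 0 \<or> i = 1 \<or> i = 2 \<or> i = 3 \<or> i = 4 \<or> i = 5" using that by arith
    then show "?xs ! i \<in> X \<longleftrightarrow> i \<in> {0, 1, 2}" "?xs ! i \<in> Y \<longleftrightarrow> i \<in> {3, 4, 5}"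
      "i \<in> {0, 1, 2} \<or> i \<in> {3, 4, 5}"
      using in' assms(7) by auto
  qed
  have adj: "E x y \<longleftrightarrow> x \<in> X \<and> y \<in> Y \<or> x \<in> Y \<and> y \<in> X" if "x \<in> X \<union> Y" "y \<in> X \<union> Y" for x y
    using that assms(7-10) by blast
  show ?thesis
  proof (rule embedsI_list)
    show "distinct ?xs" using in' assms(7) X Y by auto
    fix i j assume "i < length ?xs" "j < length ?xs"
    then have ij: "i < 6" "j < 6" by auto
    have "parcs graph_K33 = {0,1,2} \<times> {3,4,5} \<union> {3,4,5} \<times> {0,1,2}"
      by (simp only: graph_K33_def pair_pre_digraph.simps)
    then have arcs: "(i, j) \<in> parcs graph_K33 \<longleftrightarrow>
        i \<in> {0, 1, 2} \<and> j \<in> {3, 4, 5} \<or> i \<in> {3, 4, 5} \<and> j \<in> {0, 1, 2}" by blast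
    have "?xs ! i \<in> X \<union> Y" "?xs ! j \<in> X \<union> Y" unfolding Un_iff *[OF ij(1)] *[OF ij(2)]
      using *(3)[OF ij(1)] *(3)[OF ij(2)] .
    then show "E (?xs ! i) (?xs ! j) \<longleftrightarrow> (i, j) \<in> parcs graph_K33"
      by (simp only: adj arcs *(1,2)[OF ij(1)] *(1,2)[OF ij(2)])
  qed (use in' assms in \<open>auto simp: pverts_graphs\<close>)
qed

lemma embeds_K4_minusI:
  assumes "{u, v, w, x} \<subseteq> V" "symp E" "irreflp E" "E u v" "E u w" "E v w" "E u x" "E v x" "w \<noteq> x" "\<not> E w x"
  shows "embeds graph_K4_minus V E"
proof -
  have s: "E y z \<longleftrightarrow> E z y" "\<not> E y y" for y z
    using assms(2,3) by (auto simp: symp_def irreflp_def)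
  show ?thesis
  proof (rule embedsI_list)
    show "distinct [w, x, u, v]" using assms s by auto
    fix i j assume "i < length [w, x, u, v]" "j < length [w, x, u, v]"
    then have "i = 0 \<or> i = 1 \<or> i = 2 \<or> i = 3" "j = 0 \<or> j = 1 \<or> j = 2 \<or> j = 3" by auto
    then show "E ([w, x, u, v] ! i) ([w, x, u, v] ! j) \<longleftrightarrow> (i, j) \<in> parcs graph_K4_minus"
      using assms s by (auto simp: graph_K4_minus_def complete_on_def)
  qed (use assms in \<open>auto simp: pverts_graphs\<close>)
qed

lemma embeds_H0I:
  assumes "insert v (K1 \<union> K2 \<union> K3) \<subseteq> V" "symp E" "irreflp E" "card K1 = 3" "card K2 = 3" "card K3 = 3"
    "K1 \<inter> K2 = {}" "K1 \<inter> K3 = {}" "K2 \<inter> K3 = {}"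
    "\<forall>x\<in>K1 \<union> K2 \<union> K3. E v x"
    "\<And>K x y. K \<in> {K1, K2, K3} \<Longrightarrow> x \<in> K \<Longrightarrow> y \<in> K \<Longrightarrow> x \<noteq> y \<Longrightarrow> E x y"
    "\<And>x y. x \<in> K1 \<Longrightarrow> y \<in> K2 \<Longrightarrow> \<not> E x y" "\<And>x y. x \<in> K1 \<Longrightarrow> y \<in> K3 \<Longrightarrow> \<not> E x y"
    "\<And>x y. x \<in> K2 \<Longrightarrow> y \<in> K3 \<Longrightarrow> \<not> E x y"
  shows "embeds graph_H0 V E"
proof -
  have s: "E y z \<longleftrightarrow> E z y" "\<not> E y y" for y z
    using assms(2,3) by (auto simp: symp_def irreflp_def)
  obtain a b c where K1: "K1 = {a, b, c}" "a \<noteq> b" "a \<noteq> c" "b \<noteq> c" using assms(4) unfolding card_3_iff by blast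
  obtain d e f where K2: "K2 = {d, e, f}" "d \<noteq> e" "d \<noteq> f" "e \<noteq> f" using assms(5) unfolding card_3_iff by blast
  obtain g h k where K3: "K3 = {g, h, k}" "g \<noteq> h" "g \<noteq> k" "h \<noteq> k" using assms(6) unfolding card_3_iff by blast
  let ?xs = "[v, a, b, c, d, e, f, g, h, k]"
  have nv: "v \<notin> K1 \<union> K2 \<union> K3" using assms(10) s by blast
  \<comment> \<open>Distinct vertices are adjacent exactly if they lie in a common block
    \<open>insert v K\<close>; blocks are translated into index sets.\<close>
  have *: "?xs ! i \<in> insert v K1 \<longleftrightarrow> i \<in> {0, 1, 2, 3}" "?xs ! i \<in> insert v K2 \<longleftrightarrow> i \<in> {0, 4, 5, 6}"
    "?xs ! i \<in> insert v K3 \<longleftrightarrow> i \<in> {0, 7, 8, 9}"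
    "i \<in> {0, 1, 2, 3} \<or> i \<in> {0, 4, 5, 6} \<or> i \<in> {0, 7, 8, 9}" if "i < 10" for i
  proof -
    have "i = 0 \<or> i = 1 \<or> i = 2 \<or> i = 3 \<or> i = 4 \<or> i = 5 \<or> i = 6 \<or> i = 7 \<or> i = 8 \<or> i = 9" using that by arith
    then show "?xs ! i \<in> insert v K1 \<longleftrightarrow> i \<in> {0, 1, 2, 3}" "?xs ! i \<in> insert v K2 \<longleftrightarrow> i \<in> {0, 4, 5, 6}"
      "?xs ! i \<in> insert v K3 \<longleftrightarrow> i \<in> {0, 7, 8, 9}"
      "i \<in> {0, 1, 2, 3} \<or> i \<in> {0, 4, 5, 6} \<or> i \<in> {0, 7, 8, 9}"
      using assms(7-9) nv K1 K2 K3 by (elim disjE; auto)+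
  qed
  have set: "set ?xs = insert v (K1 \<union> K2 \<union> K3)" using K1 K2 K3 by auto
  have d: "distinct ?xs" using nv K1 K2 K3 assms(7-9) by auto
  have cl: "E x y" if "x \<in> insert v K" "y \<in> insert v K" "K \<in> {K1, K2, K3}" "x \<noteq> y" for x y K
    using that assms(10) assms(11)[OF that(3)] s(1) by blast
  have n: "\<not> E x y" if "x \<in> K1 \<and> y \<in> K2 \<or> x \<in> K2 \<and> y \<in> K1 \<or> x \<in> K1 \<and> y \<in> K3 \<or> x \<in> K3 \<and> y \<in> K1 \<or>
      x \<in> K2 \<and> y \<in> K3 \<or> x \<in> K3 \<and> y \<in> K2" for x y
    using that assms(12-14)[of x y] assms(12-14)[of y x] s(1)[of x y] by argo
  have co: "x \<in> insert v K1 \<and> y \<in> insert v K1 \<or>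
      x \<in> insert v K2 \<and> y \<in> insert v K2 \<or> x \<in> insert v K3 \<and> y \<in> insert v K3"
    if "x \<in> insert v (K1 \<union> K2 \<union> K3)" "y \<in> insert v (K1 \<union> K2 \<union> K3)" "E x y" for x y
    using that n[of x y] unfolding insert_iff Un_iff by argo
  have adj: "E x y \<longleftrightarrow> x \<noteq> y \<and> (x \<in> insert v K1 \<and> y \<in> insert v K1 \<or>
      x \<in> insert v K2 \<and> y \<in> insert v K2 \<or> x \<in> insert v K3 \<and> y \<in> insert v K3)"
    if "x \<in> insert v (K1 \<union> K2 \<union> K3)" "y \<in> insert v (K1 \<union> K2 \<union> K3)" for x y
    using co[OF that] cl[of x K1 y] cl[of x K2 y] cl[of x K3 y] s(2)[of x] by blast
  show ?thesis
  proof (rule embedsI_list[OF d])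
    fix i j assume "i < length ?xs" "j < length ?xs"
    then have ij: "i < 10" "j < 10" by auto
    have "(i, j) \<in> parcs graph_H0 \<longleftrightarrow> i \<noteq> j \<and> (i \<in> {0, 1, 2, 3} \<and> j \<in> {0, 1, 2, 3} \<or>
        i \<in> {0, 4, 5, 6} \<and> j \<in> {0, 4, 5, 6} \<or> i \<in> {0, 7, 8, 9} \<and> j \<in> {0, 7, 8, 9})"
      unfolding graph_H0_def pair_pre_digraph.simps complete_on_def by blast
    moreover have "?xs ! i = ?xs ! j \<longleftrightarrow> i = j"
      using nth_eq_iff_index_eq[OF d] ij by simp
    moreover have "?xs ! i \<in> insert v (K1 \<union> K2 \<union> K3)" "?xs ! j \<in> insert v (K1 \<union> K2 \<union> K3)"
      using nth_mem[of i ?xs] nth_mem[of j ?xs] ij unfolding set by simp_all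
    ultimately show "E (?xs ! i) (?xs ! j) \<longleftrightarrow> (i, j) \<in> parcs graph_H0"
      by (simp only: adj *(1-3)[OF ij(1)] *(1-3)[OF ij(2)])
  qed (use K1 K2 K3 assms(1) in \<open>auto simp: pverts_graphs\<close>)
qed

section \<open>Induced paths as ordered quadruples, and their partners\<close>

definition P4 :: "'a set \<Rightarrow> ('a \<Rightarrow> 'a \<Rightarrow> bool) \<Rightarrow> 'a \<Rightarrow> 'a \<Rightarrow> 'a \<Rightarrow> 'a \<Rightarrow> bool" where
  "P4 V E a b c d \<longleftrightarrow> {a, b, c, d} \<subseteq> V \<and> distinct [a, b, c, d] \<and>
     E a b \<and> E b c \<and> E c d \<and> \<not> E a c \<and> \<not> E a d \<and> \<not> E b d"

text \<open>By reversal, a further path through \<open>v\<close> may be assumed to have \<open>v\<close> in first or second place.\<close>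

definition P4_partner :: "'a set \<Rightarrow> ('a \<Rightarrow> 'a \<Rightarrow> bool) \<Rightarrow> 'a set \<Rightarrow> 'a \<Rightarrow> bool" where
  "P4_partner V E A v \<longleftrightarrow> v \<notin> A \<and> (\<exists>x y z. {x, y, z} \<subseteq> A \<and> (P4 V E v x y z \<or> P4 V E x v y z))"

context
  fixes G :: "('a, 'b) pre_digraph"
  assumes G: "graph G"
begin

interpretation graph G by (rule G)

lemma induces_P4I:
  assumes "P4 (verts G) (\<lambda>u v. u \<rightarrow>\<^bsub>G\<^esub> v) a b c d"
  shows "induces_P4 G {a, b, c, d}"
proof -
  let ?xs = "[a, b, c, d]"
  have s: "u \<rightarrow>\<^bsub>G\<^esub> v \<longleftrightarrow> v \<rightarrow>\<^bsub>G\<^esub> u" "\<not> (u \<rightarrow>\<^bsub>G\<^esub> u)" for u v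
    using sym_arcs adj_not_same by (auto simp: symmetric_def sym_def)
  have eq: "(!) ?xs ` pverts graph_P4 = {a, b, c, d}"
    by (auto simp: graph_P4_def)
  have "digraph_iso (G \<restriction> ((!) ?xs ` pverts graph_P4)) (with_proj graph_P4)"
  proof (rule iso_if_embedding[OF wf_digraph nomulti_digraph])
    show "inj_on ((!) ?xs) (pverts graph_P4)"
      by (rule inj_on_nth) (use assms in \<open>auto simp: P4_def graph_P4_def\<close>)
    show "(!) ?xs ` pverts graph_P4 \<subseteq> verts G" unfolding eq using assms by (simp add: P4_def)
    show "\<forall>i\<in>pverts graph_P4. \<forall>j\<in>pverts graph_P4.
        ?xs ! i \<rightarrow>\<^bsub>G\<^esub> ?xs ! j \<longleftrightarrow> (i, j) \<in> parcs graph_P4"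
      using assms s by (auto simp: P4_def graph_P4_def)
  qed (auto simp: graph_P4_def)
  then show ?thesis using assms unfolding induces_P4_def eq by (simp add: P4_def)
qed

lemma induces_P4_induce_subgraph:
  assumes "induces_P4 G B" "B \<subseteq> A"
  shows "induces_P4 (G \<restriction> A) B"
proof -
  have "(G \<restriction> A) \<restriction> B = G \<restriction> B"
    using assms(2) by (auto simp: induce_subgraph_def)
  then show ?thesis using assms by (simp add: induces_P4_def)
qed

text \<open>The path through \<open>v\<close> has another vertex set than
  \<open>{a, b, c, d}\<close>, because \<open>v\<close> is in it. This direction carries tidiness
  over to \<open>P4_partner\<close>.\<close>

lemma partner_if_P4_partner:
  assumes "P4 (verts G) (\<lambda>u v. u \<rightarrow>\<^bsub>G\<^esub> v) a b c d" "P4_partner (verts G) (\<lambda>u v. u \<rightarrow>\<^bsub>G\<^esub> v) {a, b, c, d} v"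
  shows "partner G {a, b, c, d} v"
proof -
  obtain x y z where v: "v \<notin> {a, b, c, d}" "{x, y, z} \<subseteq> {a, b, c, d}"
    and p: "P4 (verts G) (\<lambda>u v. u \<rightarrow>\<^bsub>G\<^esub> v) v x y z \<or> P4 (verts G) (\<lambda>u v. u \<rightarrow>\<^bsub>G\<^esub> v) x v y z"
    using assms(2) unfolding P4_partner_def by blast
  have "induces_P4 G {v, x, y, z}"
    using p induces_P4I[of v x y z] induces_P4I[of x v y z] by (auto simp: insert_commute)
  then have "induces_P4 (G \<restriction> ({a, b, c, d} \<union> {v})) {v, x, y, z}"
    using v by (intro induces_P4_induce_subgraph) auto
  moreover have "induces_P4 (G \<restriction> ({a, b, c, d} \<union> {v})) {a, b, c, d}"
    using induces_P4I[OF assms(1)] by (intro induces_P4_induce_subgraph) auto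
  moreover have "{v, x, y, z} \<noteq> {a, b, c, d}" using v by blast
  moreover have "v \<in> verts G" using p by (auto simp: P4_def)
  ultimately show ?thesis unfolding partner_def by metis
qed

end

section \<open>Constructing representations\<close>

fun shift :: "int \<Rightarrow> grid_path \<Rightarrow> grid_path" where
  "shift k (Horizontal y a b) = Horizontal y (a + k) (b + k)"
| "shift k (Vertical x a b) = Vertical (x + k) a b"

lemma shift_simps [simp]:
  "has_positive_length (shift k p) = has_positive_length p"
  "touch (shift k p) (shift k q) = touch p q" "compat (shift k p) (shift k q) = compat p q"
  "leftmost (shift k p) = leftmost p + k"
  by (cases p; cases q; auto)+

lemma compat_if_not_touch: "\<not> touch p q \<Longrightarrow> has_positive_length p \<Longrightarrow> has_positive_length q \<Longrightarrow> compat p q"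
  by (cases p; cases q) auto

lemma rep_union:
  assumes P: "contact_rep V E P" and Q: "contact_rep W E Q" and fin: "finite V" "finite W"
    and disj: "V \<inter> W = {}" and sep: "\<And>u v. u \<in> V \<Longrightarrow> v \<in> W \<Longrightarrow> \<not> E u v \<and> \<not> E v u"
  shows "\<exists>R. contact_rep (V \<union> W) E R"
proof -
  obtain B where B: "\<And>v. v \<in> V \<Longrightarrow> rightmost (P v) \<le> B"
    using fin(1) by (metis Max_ge finite_imageI imageI)
  obtain C where C: "\<And>v. v \<in> W \<Longrightarrow> C \<le> leftmost (Q v)"
    using fin(2) by (metis Min_le finite_imageI imageI)
  \<comment> \<open>Paths of \<open>P\<close> end at column \<open>B\<close> at the latest; after
    the shift, those of \<open>Q\<close> start at column \<open>B + 1\<close> at the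
    earliest.\<close>
  let ?R = "\<lambda>v. if v \<in> V then P v else shift (B + 1 - C) (Q v)"
  have sep': "\<not> touch (?R u) (?R v) \<and> compat (?R u) (?R v) \<and> \<not> touch (?R v) (?R u) \<and> compat (?R v) (?R u)"
    if "u \<in> V" "v \<in> W" for u v
  proof -
    have "v \<notin> V" using disj that by blast
    then have "\<not> touch (?R v) (?R u)" using touch_leftmost[of "?R v" "?R u"] B[OF that(1)] C[OF that(2)] that by auto
    then show ?thesis
      using compat_if_not_touch[of "?R u" "?R v"] P Q that touch_commute compat_commute \<open>v \<notin> V\<close>
      by (auto simp: contact_rep_def)
  qed
  have "contact_rep (V \<union> W) E ?R"
    unfolding contact_rep_def
  proof (intro conjI ballI impI)
    fix v assume "v \<in> V \<union> W"
    then show "has_positive_length (?R v)" using P Q by (auto simp: contact_rep_def)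
  next
    fix u v assume uv: "u \<in> V \<union> W" "v \<in> V \<union> W" "u \<noteq> v"
    consider "u \<in> V" "v \<in> V" | "u \<in> V" "v \<in> W" "v \<notin> V" | "v \<in> V" "u \<in> W" "u \<notin> V" | "u \<in> W" "v \<in> W" "u \<notin> V" "v \<notin> V"
      using uv disj by blast
    then have "compat (?R u) (?R v) \<and> (E u v \<longleftrightarrow> touch (?R u) (?R v))"
    proof cases
      case 1 then show ?thesis using P uv(3) by (simp add: contact_rep_def)
    next
      case 2 then show ?thesis using sep'[of u v] sep by blast
    next
      case 3 then show ?thesis using sep'[of v u] sep by blast
    next
      case 4 then show ?thesis using Q uv(3) by (simp add: contact_rep_def)
    qed
    then show "compat (?R u) (?R v)" "E u v = touch (?R u) (?R v)" by blast+
  qed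
  then show ?thesis by blast
qed

lemma rep_list:
  assumes "V = set xs" "distinct xs" "length ps = length xs" "symp E" "\<forall>p\<in>set ps. has_positive_length p"
    and "\<And>i j. i < j \<Longrightarrow> j < length xs \<Longrightarrow>
      compat (ps ! i) (ps ! j) \<and> (E (xs ! i) (xs ! j) \<longleftrightarrow> touch (ps ! i) (ps ! j))"
  shows "\<exists>P. contact_rep V E P"
proof -
  define P where "P v = ps ! (THE i. i < length xs \<and> xs ! i = v)" for v
  have P: "P (xs ! i) = ps ! i" if "i < length xs" for i
    unfolding P_def
    by (rule arg_cong[where f = "(!) ps"], rule the_equality)
      (use that assms(2) nth_eq_iff_index_eq in \<open>auto\<close>)
  have *: "compat (ps ! i) (ps ! j) \<and> (E (xs ! i) (xs ! j) \<longleftrightarrow> touch (ps ! i) (ps ! j))"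
    if "i \<noteq> j" "i < length xs" "j < length xs" for i j
  proof (cases "i < j")
    case False
    then have "j < i" using that by simp
    then show ?thesis
      using assms(6)[of j i] that assms(4) touch_commute compat_commute by (metis sympE)
  qed (use assms(6) that in blast)
  have "contact_rep V E P" unfolding contact_rep_def
  proof (intro conjI ballI impI)
    fix v assume "v \<in> V"
    then obtain i where "i < length xs" "v = xs ! i" using assms(1) by (metis in_set_conv_nth)
    then show "has_positive_length (P v)" using P assms(3,5) by simp
  next
    fix u v assume "u \<in> V" "v \<in> V" "u \<noteq> v"
    then obtain i k where "i < length xs" "u = xs ! i" "k < length xs" "v = xs ! k" "i \<noteq> k"
      using assms(1) by (metis in_set_conv_nth)
    then show "compat (P u) (P v)" "E u v = touch (P u) (P v)" using *[of i k] P by simp_all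
  qed
  then show ?thesis by blast
qed

section \<open>Explicit representations: cross, ladder and windmill\<close>

definition arm :: "nat \<Rightarrow> grid_path" where
  "arm i = [Horizontal 0 0 4, Vertical 0 0 4, Horizontal 0 (-4) 0, Vertical 0 (-4) 0] ! i"

text \<open>Arms 0 to 3 run from the origin to the right, up, left and down. Leaves of kinds 0 and 1
  meet at the tip of their arm; kind 2 sits at the middle of the arm and touches no other
  leaf.\<close>

definition leaf :: "nat \<Rightarrow> nat \<Rightarrow> grid_path" where
  "leaf i m = [[Vertical 4 0 1, Vertical 4 (-1) 0, Vertical 2 0 1],
    [Horizontal 4 0 1, Horizontal 4 (-1) 0, Horizontal 2 0 1],
    [Vertical (-4) 0 1, Vertical (-4) (-1) 0, Vertical (-2) 0 1],
    [Horizontal (-4) 0 1, Horizontal (-4) (-1) 0, Horizontal (-2) 0 1]] ! i ! m"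

lemma less_4_cases: "i < 4 \<Longrightarrow> i = 0 \<or> i = 1 \<or> i = 2 \<or> i = (3::nat)"
  and less_3_cases: "m < 3 \<Longrightarrow> m = 0 \<or> m = 1 \<or> m = (2::nat)"
  by arith+

lemma arm_leaf:
  assumes "i < 4" "i' < 4" "m < 3" "m' < 3"
  shows "has_positive_length (arm i)" "has_positive_length (leaf i m)"
    "i \<noteq> i' \<Longrightarrow> compat (arm i) (arm i') \<and> touch (arm i) (arm i')"
    "compat (arm i) (leaf i' m) \<and> (touch (arm i) (leaf i' m) \<longleftrightarrow> i = i')"
    "i \<noteq> i' \<or> m \<noteq> m' \<Longrightarrow> compat (leaf i m) (leaf i' m')"
    "i \<noteq> i' \<or> m \<noteq> m' \<Longrightarrow> touch (leaf i m) (leaf i' m') \<longleftrightarrow> i = i' \<and> m \<noteq> 2 \<and> m' \<noteq> 2"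
  using assms(1)[THEN less_4_cases] assms(2)[THEN less_4_cases] assms(3)[THEN less_3_cases] assms(4)[THEN less_3_cases]
  by (elim disjE; simp add: arm_def leaf_def)+

text \<open>Each fibre of \<open>f\<close> is numbered separately, by an injection into the numbers
  below its size.\<close>

lemma fibre_colouring:
  assumes "finite S"
  obtains j :: "'a \<Rightarrow> nat" where "\<And>s. s \<in> S \<Longrightarrow> j s < card {t\<in>S. f t = f s}"
    "\<And>s t. s \<in> S \<Longrightarrow> t \<in> S \<Longrightarrow> f s = f t \<Longrightarrow> j s = j t \<Longrightarrow> s = t"
proof -
  have "\<forall>q. \<exists>g. g ` {s\<in>S. f s = q} \<subseteq> {..<card {s\<in>S. f s = q}} \<and> inj_on g {s\<in>S. f s = q}"
    using assms by (intro allI card_le_inj) auto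
  from choice[OF this] obtain g where
    g: "\<forall>q. g q ` {s\<in>S. f s = q} \<subseteq> {..<card {s\<in>S. f s = q}} \<and> inj_on (g q) {s\<in>S. f s = q}" ..
  show thesis
  proof (rule that[of "\<lambda>s. g (f s) s"])
    fix s assume "s \<in> S"
    then show "g (f s) s < card {t\<in>S. f t = f s}" using g[rule_format, of "f s"] by auto
  next
    fix s t assume st: "s \<in> S" "t \<in> S" "f s = f t" "g (f s) s = g (f t) t"
    then show "s = t" using g[rule_format, of "f s"] by (simp add: inj_on_def)
  qed
qed

text \<open>The clique \<open>Q\<close> takes the arms of the cross, and each vertex of
  \<open>S\<close> is a leaf on the arm of its only neighbour in \<open>Q\<close>.\<close>

lemma rep_spider:
  assumes "V = Q \<union> S" "Q \<inter> S = {}" "finite V" "symp E" "irreflp E" "card Q \<le> 4"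
    and f: "\<And>s. s \<in> S \<Longrightarrow> f s \<in> Q" and fibre: "\<And>q. card {s\<in>S. f s = q} \<le> 2"
    and QQ: "\<And>q r. q \<in> Q \<Longrightarrow> r \<in> Q \<Longrightarrow> q \<noteq> r \<Longrightarrow> E q r"
    and QS: "\<And>q s. q \<in> Q \<Longrightarrow> s \<in> S \<Longrightarrow> E q s \<longleftrightarrow> q = f s"
    and SS: "\<And>s t. s \<in> S \<Longrightarrow> t \<in> S \<Longrightarrow> E s t \<Longrightarrow> f s = f t"
  shows "\<exists>P. contact_rep V E P"
proof -
  have s: "E y z \<longleftrightarrow> E z y" "\<not> E y y" for y z
    using assms(4,5) by (auto simp: symp_def irreflp_def)
  have fin: "finite Q" "finite S" using assms(1,3) by auto
  obtain \<alpha> where \<alpha>: "\<alpha> ` Q \<subseteq> {..<4::nat}" "inj_on \<alpha> Q"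
    using card_le_inj[of Q "{..<4::nat}"] fin assms(6) by auto
  obtain j :: "'a \<Rightarrow> nat" where j': "\<And>s. s \<in> S \<Longrightarrow> j s < card {t\<in>S. f t = f s}"
    and j_inj: "\<And>s t. s \<in> S \<Longrightarrow> t \<in> S \<Longrightarrow> f s = f t \<Longrightarrow> j s = j t \<Longrightarrow> s = t"
    using fibre_colouring[OF fin(2), of f] by blast
  have j: "j s < 2" if "s \<in> S" for s using j'[OF that] fibre[of "f s"] by linarith
  \<comment> \<open>The first vertex of a fibre gets kind 0; the second gets kind 1 if it is
    adjacent to the first and kind 2 otherwise.\<close>
  define m where "m s = (if j s = 0 then 0 else if \<exists>t\<in>S. f t = f s \<and> E s t then 1 else (2::nat))" for s
  define P where "P v = (if v \<in> Q then arm (\<alpha> v) else leaf (\<alpha> (f v)) (m v))" for v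
  have m3: "m v < 3" for v by (simp add: m_def)
  have a4: "\<alpha> q < 4" if "q \<in> Q" for q using \<alpha> that by auto
  have PQ: "P v = arm (\<alpha> v)" if "v \<in> Q" for v using that by (simp add: P_def)
  have PS: "P v = leaf (\<alpha> (f v)) (m v)" if "v \<in> S" for v using that assms(2) by (auto simp: P_def)
  have \<alpha>_eq: "\<alpha> q = \<alpha> r \<longleftrightarrow> q = r" if "q \<in> Q" "r \<in> Q" for q r using that \<alpha>(2) by (auto simp: inj_on_def)
  have qs: "compat (P q) (P s) \<and> (E q s \<longleftrightarrow> touch (P q) (P s))" if "q \<in> Q" "s \<in> S" for q s
    using arm_leaf(4)[of "\<alpha> q" "\<alpha> (f s)" "m s" 0] a4 f that m3 QS \<alpha>_eq by (auto simp: PQ PS)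
  have "contact_rep V E P" unfolding contact_rep_def
  proof (intro conjI ballI impI)
    fix v assume "v \<in> V"
    then show "has_positive_length (P v)"
      using arm_leaf(1)[of "\<alpha> v" 0 0 0] arm_leaf(2)[of "\<alpha> (f v)" 0 "m v" 0] a4 f m3 assms(1) by (auto simp: P_def)
  next
    fix u v assume uv: "u \<in> V" "v \<in> V" "u \<noteq> v"
    consider "u \<in> Q" "v \<in> Q" | "u \<in> Q" "v \<in> S" | "v \<in> Q" "u \<in> S" | "u \<in> S" "v \<in> S"
      using uv assms(1) by blast
    then have "compat (P u) (P v) \<and> (E u v \<longleftrightarrow> touch (P u) (P v))"
    proof cases
      case 1 then show ?thesis
        using arm_leaf(3)[of "\<alpha> u" "\<alpha> v" 0 0] a4 QQ \<alpha>_eq uv(3) by (auto simp: PQ)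
    next
      case 2 then show ?thesis using qs by blast
    next
      case 3 then show ?thesis using qs[of v u] s(1) touch_commute compat_commute by blast
    next
      case 4
      note L = arm_leaf(5,6)[of "\<alpha> (f u)" "\<alpha> (f v)" "m u" "m v"]
      show ?thesis
      proof (cases "f u = f v")
        case False
        then have "\<alpha> (f u) \<noteq> \<alpha> (f v)" using \<alpha>_eq f 4 by blast
        then show ?thesis using L a4 f 4 m3 SS False by (auto simp: PS)
      next
        case True
        then have jj: "j u \<noteq> j v" using j_inj 4 uv(3) by blast
        \<comment> \<open>A fibre has only the numbers 0 and 1, so \<open>u\<close> and
          \<open>v\<close> fill it, and the existential condition in \<open>m_def\<close> decides
          whether they are adjacent.\<close>
        have third: "t = u \<or> t = v" if "t \<in> S" "f t = f u" for t
        proof -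
          have "j t = j u \<or> j t = j v" using j[of t] j[of u] j[of v] jj that 4 by linarith
          then show ?thesis using j_inj that 4 True by metis
        qed
        have E: "(\<exists>t\<in>S. f t = f u \<and> E u t) \<longleftrightarrow> E u v" "(\<exists>t\<in>S. f t = f v \<and> E v t) \<longleftrightarrow> E u v"
          using third True 4 s by metis+
        have "j u = 0 \<and> j v = 1 \<or> j u = 1 \<and> j v = 0" using j[of u] j[of v] jj 4 by auto
        then have "m u \<noteq> m v \<and> (E u v \<longleftrightarrow> m u \<noteq> 2 \<and> m v \<noteq> 2)" unfolding m_def E by auto
        then show ?thesis using L a4 f 4 m3 True by (auto simp: PS)
      qed
    qed
    then show "compat (P u) (P v)" "E u v = touch (P u) (P v)" by blast+
  qed
  then show ?thesis by blast
qed

lemma rep_K2n: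
  assumes "V = {a, b} \<union> Y" "a \<noteq> b" "{a, b} \<inter> Y = {}" "finite Y" "symp E"
    and "\<not> E a b" "\<And>y. y \<in> Y \<Longrightarrow> E a y \<and> E b y" "\<And>y z. y \<in> Y \<Longrightarrow> z \<in> Y \<Longrightarrow> \<not> E y z"
  shows "\<exists>P. contact_rep V E P"
proof -
  obtain e :: "'a \<Rightarrow> nat" where e: "inj_on e Y" "e ` Y \<subseteq> {..<card Y}"
    using card_le_inj[of Y "{..<card Y}"] assms(4) by auto
  have e': "e y < card Y" if "y \<in> Y" for y using e that by blast
  have s: "E y z \<longleftrightarrow> E z y" for y z using assms(5) by (auto simp: symp_def)
  \<comment> \<open>A ladder: \<open>a\<close> and \<open>b\<close> are two rows, the vertices of
    \<open>Y\<close> its rungs. The added 1 keeps the rows of positive length when \<open>Y\<close>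
    is empty.\<close>
  let ?n = "int (card Y) + 1"
  let ?P = "\<lambda>v. if v = a then Horizontal 0 0 ?n else if v = b then Horizontal 1 0 ?n else Vertical (int (e v)) 0 1"
  have "\<not> E b a" "\<And>y. y \<in> Y \<Longrightarrow> E y a \<and> E y b" using assms(6,7) s by blast+
  then have "contact_rep V E ?P"
    using assms e' e(1) unfolding contact_rep_def
    by (auto simp: inj_on_eq_iff less_imp_le le_Suc_eq intro: order_trans[OF less_imp_le])
  then show ?thesis by blast
qed

text \<open>The hub \<open>c\<close> is a row from column 0 to \<open>M\<close>, and each clique is
  gathered at its column \<open>q\<close>: \<open>j = 0\<close> above the row, \<open>j = 1\<close>
  below it, and \<open>j = 2\<close> as a continuation of the row past one of its ends.\<close>

lemma rep_windmill:
  fixes q :: "'a \<Rightarrow> int" and j :: "'a \<Rightarrow> nat"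
  assumes "V = insert c N" "c \<notin> N" "symp E" "0 < M"
    and "\<And>x. x \<in> N \<Longrightarrow> E c x"
    and q: "\<And>x. x \<in> N \<Longrightarrow> 0 \<le> q x \<and> q x \<le> M" and j: "\<And>x. x \<in> N \<Longrightarrow> j x < 3"
    and j2: "\<And>x. x \<in> N \<Longrightarrow> j x = 2 \<Longrightarrow> q x = 0 \<or> q x = M"
    and E: "\<And>x y. x \<in> N \<Longrightarrow> y \<in> N \<Longrightarrow> x \<noteq> y \<Longrightarrow> E x y \<longleftrightarrow> q x = q y"
    and inj: "\<And>x y. x \<in> N \<Longrightarrow> y \<in> N \<Longrightarrow> q x = q y \<Longrightarrow> j x = j y \<Longrightarrow> x = y"
  shows "\<exists>P. contact_rep V E P"
proof -
  define P where "P v = (if v = c then Horizontal 0 0 M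
    else if j v = 0 then Vertical (q v) 0 1 else if j v = 1 then Vertical (q v) (-1) 0
    else if q v = 0 then Horizontal 0 (-1) 0 else Horizontal 0 M (M + 1))" for v
  have s: "E y z \<longleftrightarrow> E z y" for y z using assms(3) by (auto simp: symp_def)
  have c: "compat (P c) (P v) \<and> touch (P c) (P v)" if "v \<in> N" for v
    using that q[OF that] assms(2,4) by (auto simp: P_def)
  have "contact_rep V E P" unfolding contact_rep_def
  proof (intro conjI ballI impI)
    fix v assume "v \<in> V"
    then show "has_positive_length (P v)" using assms(4) by (simp add: P_def)
  next
    fix u v assume uv: "u \<in> V" "v \<in> V" "u \<noteq> v"
    consider "u = c" "v \<in> N" | "v = c" "u \<in> N" | "u \<in> N" "v \<in> N"
      using uv assms(1) by blast
    then have "compat (P u) (P v) \<and> (E u v \<longleftrightarrow> touch (P u) (P v))"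
    proof cases
      case 1 then show ?thesis using c assms(5) by blast
    next
      case 2 then show ?thesis using c[of u] assms(5)[of u] s touch_commute compat_commute by blast
    next
      case 3
      have "u \<noteq> c" "v \<noteq> c" using 3 assms(2) by auto
      have ju: "j u = 0 \<or> j u = 1 \<or> j u = 2" and jv: "j v = 0 \<or> j v = 1 \<or> j v = 2"
        using j 3 less_3_cases by blast+
      have "q u = q v \<Longrightarrow> j u \<noteq> j v" using inj 3 uv(3) by blast
      then show ?thesis
        using ju jv E[OF 3 uv(3)] \<open>u \<noteq> c\<close> \<open>v \<noteq> c\<close> q[OF 3(1)] q[OF 3(2)] j2[OF 3(1)] j2[OF 3(2)] assms(4)
        by (auto simp: P_def)
    qed
    then show "compat (P u) (P v)" "E u v = touch (P u) (P v)" by blast+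
  qed
  then show ?thesis by blast
qed

section \<open>Structure of tidy graphs without the forbidden subgraphs\<close>

locale tidy_free_graph =
  fixes V :: "'a set" and E :: "'a \<Rightarrow> 'a \<Rightarrow> bool"
  assumes finite_V: "finite V" and symp_E: "symp E" and irreflp_E: "irreflp E"
    and tidy: "P4 V E a b c d \<Longrightarrow> P4_partner V E {a, b, c, d} v \<Longrightarrow> P4_partner V E {a, b, c, d} w \<Longrightarrow> v = w"
    and free: "H \<in> {graph_K5, graph_K33, graph_H0, graph_K4_minus} \<Longrightarrow> \<not> embeds H V E"
begin

lemma adj_sym: "E u v \<longleftrightarrow> E v u" and adj_irrefl [simp]: "\<not> E u u"
  using symp_E irreflp_E by (auto simp: symp_def irreflp_def)

text \<open>Otherwise \<open>K4_minus\<close> would be induced. Consequently each edge lies in only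
  one maximal clique.\<close>

lemma diamond:
  assumes "u \<in> V" "v \<in> V" "w \<in> V" "x \<in> V" "E u v" "E u w" "E v w" "E u x" "E v x" "w \<noteq> x"
  shows "E w x"
  using embeds_K4_minusI[of u v w x V E] assms symp_E irreflp_E free[of graph_K4_minus] by auto

lemma clique_card_le_4:
  assumes "K \<subseteq> V" "\<And>u v. u \<in> K \<Longrightarrow> v \<in> K \<Longrightarrow> u \<noteq> v \<Longrightarrow> E u v"
  shows "card K \<le> 4"
proof (rule ccontr)
  assume "\<not> ?thesis"
  moreover have "finite K" using assms(1) finite_V finite_subset by blast
  moreover have "\<forall>u\<in>K. \<forall>v\<in>K. u \<noteq> v \<longleftrightarrow> E u v" using assms(2) adj_irrefl by blast
  ultimately show False using embeds_K5I[OF assms(1)] free[of graph_K5] by auto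
qed

lemma P4D:
  assumes "P4 V E a b c d"
  shows "a \<in> V" "b \<in> V" "c \<in> V" "d \<in> V" "a \<noteq> b" "a \<noteq> c" "a \<noteq> d" "b \<noteq> c" "b \<noteq> d" "c \<noteq> d"
    "E a b" "E b a" "E b c" "E c b" "E c d" "E d c"
    "\<not> E a c" "\<not> E c a" "\<not> E a d" "\<not> E d a" "\<not> E b d" "\<not> E d b"
  using assms adj_sym by (auto simp: P4_def)

lemma P4I:
  assumes "a \<in> V" "b \<in> V" "c \<in> V" "d \<in> V" "E a b" "E b c" "E c d" "\<not> E a c" "\<not> E a d" "\<not> E b d"
  shows "P4 V E a b c d"
  using assms adj_sym by (auto simp: P4_def)

lemma P4_neighbours:
  assumes A: "P4 V E a b c d" and v: "v \<in> V" "v \<notin> {a, b, c, d}" "\<not> P4_partner V E {a, b, c, d} v"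
  shows "\<not> E v a" "\<not> E v d" "E v b \<longleftrightarrow> E v c"
proof -
  note A' = P4D[OF A]
  have n: "\<not> P4 V E v x y z \<and> \<not> P4 V E x v y z" if "{x, y, z} \<subseteq> {a, b, c, d}" for x y z
    using v that unfolding P4_partner_def by blast
  \<comment> \<open>Facts 1 to 8 exclude patterns of neighbours of \<open>v\<close> that create a
    further induced path; 9 and 10 exclude diamonds. Only the empty pattern and \<open>b\<close>,
    \<open>c\<close> alone remain.\<close>
  have 1: "\<not> (E v a \<and> \<not> E v b \<and> \<not> E v c)" using n[of a b c] P4I[of v a b c] A' v by auto
  have 2: "\<not> (E v b \<and> \<not> E v c \<and> \<not> E v d)" using n[of b c d] P4I[of v b c d] A' v by auto
  have 3: "\<not> (E v d \<and> \<not> E v c \<and> \<not> E v b)" using n[of d c b] P4I[of v d c b] A' v by auto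
  have 4: "\<not> (E v c \<and> \<not> E v b \<and> \<not> E v a)" using n[of c b a] P4I[of v c b a] A' v by auto
  have 5: "\<not> (E v a \<and> E v c \<and> \<not> E v d)" using n[of a c d] P4I[of a v c d] A' v adj_sym[of v a] by auto
  have 6: "\<not> (E v d \<and> E v b \<and> \<not> E v a)" using n[of d b a] P4I[of d v b a] A' v adj_sym[of v d] by auto
  have 7: "\<not> (E v a \<and> E v d \<and> \<not> E v c)" using n[of a d c] P4I[of a v d c] A' v adj_sym[of v a] by auto
  have 8: "\<not> (E v d \<and> E v a \<and> \<not> E v b)" using n[of d a b] P4I[of d v a b] A' v adj_sym[of v d] by auto
  have 9: "\<not> (E v a \<and> E v b \<and> E v c)" using diamond[of v b a c] A' v by auto
  have 10: "\<not> (E v b \<and> E v c \<and> E v d)" using diamond[of v c b d] A' v by auto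
  show "\<not> E v a" "\<not> E v d" "E v b \<longleftrightarrow> E v c"
    using 1 2 3 4 5 6 7 8 9 10 by argo+
qed

text \<open>Tidiness makes \<open>p\<close> the only partner, so \<open>P4_neighbours\<close>
  applies to every other vertex outside the path.\<close>

lemma other_not_partner:
  assumes "P4 V E a b c d" "P4_partner V E {a, b, c, d} p" "v \<in> V" "v \<notin> {a, b, c, d, p}"
  shows "\<not> E v a" "\<not> E v d" "E v b \<longleftrightarrow> E v c"
proof -
  have "\<not> P4_partner V E {a, b, c, d} v" using tidy[OF assms(1,2)] assms(4) by blast
  then show "\<not> E v a" "\<not> E v d" "E v b \<longleftrightarrow> E v c"
    using P4_neighbours[OF assms(1)] assms(3,4) by blast+
qed

lemma P4_partnerI:
  assumes "P4 V E a b c d" "v \<in> V" "v \<notin> {a, b, c, d}" "E v a \<or> E v d \<or> (E v b \<longleftrightarrow> \<not> E v c)"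
  shows "P4_partner V E {a, b, c, d} v"
  using P4_neighbours[OF assms(1-3)] assms(4) by blast

end

section \<open>Connected graphs with an induced path on four vertices\<close>

locale connected_tidy_free_graph = tidy_free_graph +
  assumes connected: "S \<subset> V \<Longrightarrow> S \<noteq> {} \<Longrightarrow> \<exists>x\<in>S. \<exists>y\<in>V - S. E x y"
begin

text \<open>Connectedness as a closure principle, used to show that the vertices found so far
  exhaust \<open>V\<close>.\<close>

lemma eq_if_no_outer_edge:
  assumes "S \<subseteq> V" "S \<noteq> {}" "\<And>x y. x \<in> S \<Longrightarrow> y \<in> V \<Longrightarrow> y \<notin> S \<Longrightarrow> E y x \<Longrightarrow> False"
  shows "V = S"
  using connected[of S] assms adj_sym by blast

text \<open>The adjacencies of \<open>p\<close> to \<open>a\<close> and \<open>b\<close> give a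
  house, a five-cycle, a four-cycle with a pendant edge or a five-vertex path. In each, another four
  of the vertices induce a path with the fifth as partner. The restrictions from both paths cut off
  every outside vertex.\<close>

lemma rep_if_five_vertices:
  assumes A: "P4 V E a b c d" and p: "p \<in> V" "p \<notin> {a, b, c, d}" "E p d" "\<not> E p c"
  shows "\<exists>P. contact_rep V E P"
proof -
  note A' = P4D[OF A]
  have p': "p \<noteq> a" "p \<noteq> b" "p \<noteq> c" "p \<noteq> d" "E d p" "\<not> E c p" using p adj_sym by auto
  have 1: "P4_partner V E {a, b, c, d} p" using P4_partnerI[OF A] p by blast
  note v1 = other_not_partner[OF A 1]
  have V: "V = set [a, b, c, d, p]"
    if "\<And>v. v \<in> V \<Longrightarrow> v \<notin> {a, b, c, d, p} \<Longrightarrow> \<not> E v a \<and> \<not> E v b \<and> \<not> E v c \<and> \<not> E v d \<and> \<not> E v p"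
    by (rule eq_if_no_outer_edge) (use that A' p in auto)
  have lt5: "\<exists>P. contact_rep V E P" if "length ps = 5 \<and> (\<forall>q\<in>set ps. has_positive_length q) \<and>
      (\<forall>i j. i < j \<longrightarrow> j < 5 \<longrightarrow> compat (ps ! i) (ps ! j) \<and>
        (E ([a, b, c, d, p] ! i) ([a, b, c, d, p] ! j) \<longleftrightarrow> touch (ps ! i) (ps ! j)))"
    "V = set [a, b, c, d, p]" for ps
  proof (rule rep_list[OF that(2) _ _ symp_E, of ps])
    show "distinct [a, b, c, d, p]" using A' p' by auto
    fix i j assume "i < j" "j < length [a, b, c, d, p]"
    moreover from this have "j < 5" by simp
    ultimately show "compat (ps ! i) (ps ! j) \<and>
        (E ([a, b, c, d, p] ! i) ([a, b, c, d, p] ! j) \<longleftrightarrow> touch (ps ! i) (ps ! j))"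
      using that(1) by blast
  qed (use that in auto)
  have ij: "(\<forall>i j. i < j \<longrightarrow> j < 5 \<longrightarrow> \<Phi> i j) \<longleftrightarrow>
      \<Phi> 0 1 \<and> \<Phi> 0 2 \<and> \<Phi> 0 3 \<and> \<Phi> 0 4 \<and> \<Phi> 1 2 \<and> \<Phi> 1 3 \<and> \<Phi> 1 4 \<and> \<Phi> 2 3 \<and> \<Phi> 2 4 \<and> \<Phi> 3 (4::nat)"
    (is "?l \<longleftrightarrow> ?r") for \<Phi>
  proof
    show "?l \<Longrightarrow> ?r" by simp
    show "?r \<Longrightarrow> ?l" by (auto simp: numeral_eq_Suc less_Suc_eq)
  qed
  show ?thesis
  proof (cases "E p a")
    case pa: True
    then have pa': "E a p" using adj_sym by blast
    show ?thesis
    proof (cases "E p b")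
      case True
      have B: "P4 V E a p d c" using P4I[of a p d c] A' p pa' by blast
      have "P4_partner V E {a, p, d, c} b" by (rule P4_partnerI[OF B]) (use A' p' in auto)
      note v2 = other_not_partner[OF B this]
      have "V = set [a, b, c, d, p]" using v1 v2 by (intro V) auto
      moreover have "E b p" using True adj_sym by blast
      \<comment> \<open>The house: \<open>b\<close>, \<open>c\<close>, \<open>d\<close>,
        \<open>p\<close> are the sides of a unit square, and \<open>a\<close> continues
        \<open>b\<close> past its corner with \<open>p\<close>.\<close>
      ultimately show ?thesis
        by (intro lt5[of "[Horizontal 0 1 2, Horizontal 0 0 1, Vertical 0 0 1, Horizontal 1 0 1, Vertical 1 0 1]"])
          (use A' p' pa' in \<open>simp_all add: ij\<close>)
    next
      case False
      have B: "P4 V E b c d p" using P4I[of b c d p] A' p' p False adj_sym by blast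
      have "P4_partner V E {b, c, d, p} a" by (rule P4_partnerI[OF B]) (use A' p' in auto)
      note v2 = other_not_partner[OF B this]
      have "V = set [a, b, c, d, p]" using v1 v2 by (intro V) auto
      moreover have "\<not> E b p" using False adj_sym by blast
      \<comment> \<open>The five-cycle: a rectangle of width two whose lower side is divided between
        \<open>a\<close> and \<open>b\<close>.\<close>
      ultimately show ?thesis
        by (intro lt5[of "[Horizontal 0 0 1, Horizontal 0 1 2, Vertical 2 0 1, Horizontal 1 0 2, Vertical 0 0 1]"])
          (use A' p' pa' in \<open>simp_all add: ij\<close>)
    qed
  next
    case pa: False
    then have pa': "\<not> E a p" using adj_sym by blast
    show ?thesis
    proof (cases "E p b")
      case True
      then have bp: "E b p" using adj_sym by blast
      have B: "P4 V E a b p d" using P4I[of a b p d] A' p pa' bp by blast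
      have "P4_partner V E {a, b, p, d} c" by (rule P4_partnerI[OF B]) (use A' p' in auto)
      note v2 = other_not_partner[OF B this]
      \<comment> \<open>Otherwise \<open>v\<close> would see all of \<open>b\<close>,
        \<open>c\<close> and \<open>p\<close>; then \<open>c\<close> and \<open>p\<close>, as common
        neighbours of the ends of the edge \<open>v b\<close>, would be adjacent.\<close>
      have "\<not> E v b" if "v \<in> V" "v \<notin> {a, b, c, d, p}" for v
        using v1(3)[of v] v2(3)[of v] diamond[of v b c p] that A' p p' bp by auto
      then have "V = set [a, b, c, d, p]" using v1 v2 by (intro V) auto
      \<comment> \<open>The four-cycle surrounds a unit square; \<open>b\<close> is prolonged past
        its corner with \<open>p\<close>, and \<open>a\<close> is attached at its far end.\<close>
      then show ?thesis
        by (intro lt5[of "[Horizontal 0 2 3, Horizontal 0 0 2, Vertical 0 0 1, Horizontal 1 0 1, Vertical 1 0 1]"]) 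
          (use A' p' pa' bp in \<open>simp_all add: ij\<close>)
    next
      case False
      have B: "P4 V E b c d p" using P4I[of b c d p] A' p' p False adj_sym by blast
      have "P4_partner V E {b, c, d, p} a" by (rule P4_partnerI[OF B]) (use A' p' in auto)
      note v2 = other_not_partner[OF B this]
      have "V = set [a, b, c, d, p]" using v1 v2 by (intro V) auto
      moreover have "\<not> E b p" using False adj_sym by blast
      ultimately show ?thesis
        by (intro lt5[of "[Horizontal 0 0 1, Horizontal 0 1 2, Horizontal 0 2 3, Horizontal 0 3 4, Horizontal 0 4 5]"])
          (use A' p' pa' in \<open>simp_all add: ij\<close>)
    qed
  qed
qed

text \<open>\<open>plain\<close> says that the preceding five-vertex situation never occurs. It is
  used to verify the hypotheses of \<open>rep_spider\<close> for the maximal clique \<open>Q\<close>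
  through \<open>b c\<close>.\<close>

lemma rep_if_no_five_vertices:
  assumes A: "P4 V E a b c d"
    and plain: "\<And>a b c d p. P4 V E a b c d \<Longrightarrow> p \<in> V \<Longrightarrow> p \<notin> {a, b, c, d} \<Longrightarrow> E p d \<Longrightarrow> E p c"
  shows "\<exists>P. contact_rep V E P"
proof -
  note A' = P4D[OF A]
  define Q where "Q = insert b (insert c {v \<in> V. E v b \<and> E v c})"
  have Q: "b \<in> Q" "c \<in> Q" "Q \<subseteq> V" using A' by (auto simp: Q_def)
  have clique: "E u v" if "u \<in> Q" "v \<in> Q" "u \<noteq> v" for u v
    using that diamond[of b c u v] A' adj_sym by (auto simp: Q_def)
  \<comment> \<open>By the diamond property, a vertex with two neighbours in \<open>Q\<close> would
    see all of \<open>Q\<close>; seeing \<open>b\<close> and \<open>c\<close> puts it into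
    \<open>Q\<close>.\<close>
  have unique: "q = q'" if "v \<in> V" "v \<notin> Q" "q \<in> Q" "q' \<in> Q" "E v q" "E v q'" for v q q'
  proof (rule ccontr)
    assume "q \<noteq> q'"
    then have "E v r" if "r \<in> Q" for r
      using diamond[of q q' v r] clique[of q q'] clique[of q r] clique[of q' r] that Q \<open>v \<in> V\<close> \<open>v \<notin> Q\<close>
        \<open>q \<in> Q\<close> \<open>q' \<in> Q\<close> \<open>E v q\<close> \<open>E v q'\<close> adj_sym by blast
    then have "E v b" "E v c" using Q by blast+
    then show False using that by (simp add: Q_def)
  qed
  have ad: "a \<notin> Q" "d \<notin> Q" using A' by (auto simp: Q_def)
  have rev: "P4 V E d c b a" using P4I[of d c b a] A' by blast
  text \<open>All neighbours \<open>s\<close> of \<open>q\<close> outside \<open>Q\<close> complete the same \<open>x, y, q\<close> to an induced \<open>P\<^sub>4\<close>, so tidiness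
    allows at most two of them.\<close>
  have L: "P4 V E x y q s"
    if P: "P4 V E x y z w" and "{y, z} = {b, c}" and xw: "x \<notin> Q" "w \<notin> Q" and q: "q \<in> Q" "q \<noteq> y"
      and s: "s \<in> V" "s \<notin> Q" "E s q" for x y z w q s
  proof -
    note P' = P4D[OF P]
    have yz: "y \<in> Q" "z \<in> Q" using that(2) Q by (auto simp: doubleton_eq_iff)
    have "\<not> E x q" using unique[of x y q] P' xw q yz by blast
    moreover have ys: "\<not> E s y" using unique[of s y q] s q yz by blast
    \<comment> \<open>Otherwise \<open>s\<close> sees the end \<open>x\<close> of the path
      \<open>w z y x\<close> but not \<open>y\<close>, against \<open>plain\<close>.\<close>
    moreover have "\<not> E s x"
    proof
      assume sx: "E s x"
      have "P4 V E w z y x" using P4I[of w z y x] P' by blast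
      moreover have "s \<notin> {w, z, y, x}" using sx P' s yz ys by auto
      ultimately show False using plain[of w z y x s] s(1) sx ys by blast
    qed
    ultimately show ?thesis using P4I[of x y q s] P' Q q s clique[of y q] yz adj_sym by blast
  qed
  have L': "\<exists>x y. x \<notin> Q \<and> y \<in> Q \<and> E x y \<and> (\<forall>s. s \<in> V \<longrightarrow> s \<notin> Q \<longrightarrow> E s q \<longrightarrow> P4 V E x y q s)" if "q \<in> Q" for q
  proof (cases "q = b")
    case True
    then show ?thesis using L[OF rev, of q] that ad A' Q by (intro exI[of _ d] exI[of _ c]) auto
  next
    case False
    then show ?thesis using L[OF A, of q] that ad A' Q by (intro exI[of _ a] exI[of _ b]) auto
  qed
  \<comment> \<open>Since \<open>t\<close> sees the end \<open>s\<close> of the path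
    \<open>x y q s\<close>, it sees \<open>q\<close> by \<open>plain\<close>. Hence no vertex is at
    distance two from \<open>Q\<close>.\<close>
  have pend: "E t q" if "s \<in> V" "s \<notin> Q" "q \<in> Q" "E s q" "t \<in> V" "t \<notin> Q" "E t s" for s t q
  proof -
    note h = that
    obtain x y where xy: "x \<notin> Q" "y \<in> Q" "E x y" "P4 V E x y q s" using L'[OF h(3)] h by blast
    note P' = P4D[OF xy(4)]
    have "t \<notin> {x, y, q, s}" using h P' xy adj_irrefl by auto
    then show ?thesis using plain[OF xy(4)] h by blast
  qed
  have V: "V = Q \<union> {v\<in>V. \<exists>q\<in>Q. E v q}"
  proof (rule eq_if_no_outer_edge)
    fix x y assume *: "x \<in> Q \<union> {v\<in>V. \<exists>q\<in>Q. E v q}" "y \<in> V" "y \<notin> Q \<union> {v\<in>V. \<exists>q\<in>Q. E v q}" "E y x"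
    then show False using pend[of x _ y] by blast
  qed (use Q in auto)
  define f where "f s = (SOME q. q \<in> Q \<and> E s q)" for s
  have f: "f s \<in> Q \<and> E s (f s)" if "s \<in> V - Q" for s
    unfolding f_def using V that by (intro someI_ex[of "\<lambda>q. q \<in> Q \<and> E s q"]) blast
  have f_eq: "f s = q" if "s \<in> V - Q" "q \<in> Q" "E s q" for s q
    using unique[of s "f s" q] f that by blast
  show ?thesis
  proof (rule rep_spider[OF _ _ finite_V symp_E irreflp_E, where Q = Q and S = "V - Q" and f = f])
    show "card Q \<le> 4" using clique_card_le_4[of Q] Q clique by blast
    show "card {s \<in> V - Q. f s = q} \<le> 2" for q
    proof (cases "\<exists>s\<in>V - Q. f s = q")
      case True
      then obtain s where s: "s \<in> V" "s \<notin> Q" "f s = q" "q \<in> Q" "E s q" using f by blast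
      obtain x y where xy: "x \<notin> Q" "y \<in> Q" "E x y" "P4 V E x y q s" using L'[OF s(4)] s by blast
      note P' = P4D[OF xy(4)]
      \<comment> \<open>\<open>t\<close> sees \<open>q\<close> but not \<open>y\<close>, which makes
        it a partner of the path ending in \<open>s\<close>; tidiness allows only one such
        \<open>t\<close>.\<close>
      have pt: "P4_partner V E {x, y, q, s} t" if t: "t \<in> V - Q" "f t = q" "t \<noteq> s" for t
      proof (rule P4_partnerI[OF xy(4)])
        have tq: "E t q" using f t by blast
        then have "\<not> E t y" using unique[of t y q] t xy s P' by blast
        then show "E t x \<or> E t s \<or> (E t y \<longleftrightarrow> \<not> E t q)" using tq by blast
        show "t \<notin> {x, y, q, s}" using t tq P' xy s by auto
      qed (use t in blast)
      then have "\<exists>t. {s \<in> V - Q. f s = q} \<subseteq> {s, t}"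
        using tidy[OF xy(4)] by blast
      then obtain t where "{s \<in> V - Q. f s = q} \<subseteq> {s, t}" ..
      then have "card {s \<in> V - Q. f s = q} \<le> card {s, t}" by (intro card_mono) auto
      also have "\<dots> \<le> 2" by (simp add: card_insert_if)
      finally show ?thesis .
    next
      case False
      then have "{s \<in> V - Q. f s = q} = {}" by blast
      then show ?thesis by (simp only: card.empty)
    qed
    show "E q s \<longleftrightarrow> q = f s" if "q \<in> Q" "s \<in> V - Q" for q s
      using f[of s] f_eq[of s q] that adj_sym by blast
    show "f s = f t" if "s \<in> V - Q" "t \<in> V - Q" "E s t" for s t
    proof -
      have "E t (f s)" using pend[of s "f s" t] f[of s] that adj_sym by blast
      then show ?thesis using f_eq[of t "f s"] f[of s] that by metis
    qed
  qed (use Q f clique in auto)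
qed

lemma rep_if_P4: "P4 V E a b c d \<Longrightarrow> \<exists>P. contact_rep V E P"
  using rep_if_five_vertices rep_if_no_five_vertices by metis

end

section \<open>Connected graphs without an induced path on four vertices\<close>

context connected_tidy_free_graph
begin

text \<open>By the diamond property with \<open>v\<close>, adjacency is transitive on
  \<open>N\<close>, so the sets \<open>cl x\<close> are the cliques that partition \<open>N\<close>.
  They become the blades of a windmill with hub \<open>v\<close>, with the triangles at the two
  ends.\<close>

lemma rep_if_dominating:
  assumes v: "v \<in> V" "\<And>u. u \<in> V \<Longrightarrow> u \<noteq> v \<Longrightarrow> E v u"
  shows "\<exists>P. contact_rep V E P"
proof -
  define N where "N = V - {v}"
  have N: "V = insert v N" "v \<notin> N" "finite N" using v(1) finite_V by (auto simp: N_def)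
  have vN: "E v x" "E x v" if "x \<in> N" for x using v(2) that adj_sym by (auto simp: N_def)
  define cl where "cl x = {y \<in> N. y = x \<or> E x y}" for x
  have tr: "E x z" if "x \<in> N" "y \<in> N" "z \<in> N" "E x y" "E y z" "x \<noteq> z" for x y z
    using diamond[of v y x z] that vN adj_sym N(1) by blast
  have cl_eq: "cl x = cl y \<longleftrightarrow> x = y \<or> E x y" if "x \<in> N" "y \<in> N" for x y
  proof
    assume "cl x = cl y"
    moreover have "y \<in> cl y" using that by (simp add: cl_def)
    ultimately show "x = y \<or> E x y" by (auto simp: cl_def)
  next
    assume "x = y \<or> E x y"
    then show "cl x = cl y" using tr that adj_sym unfolding cl_def by blast
  qed
  have fib: "{y \<in> N. cl y = cl x} = cl x" if "x \<in> N" for x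
  proof -
    have "{y \<in> N. cl y = cl x} = {y \<in> N. y = x \<or> E y x}" using cl_eq that by blast
    also have "\<dots> = cl x" using adj_sym by (auto simp: cl_def)
    finally show ?thesis .
  qed
  have cl_sub: "cl x \<subseteq> N" "finite (cl x)" for x using N(3) by (auto simp: cl_def)
  have cl_clique: "E y z" if "x \<in> N" "y \<in> cl x" "z \<in> cl x" "y \<noteq> z" for x y z
    using that tr[of y x z] adj_sym by (auto simp: cl_def)
  have card_cl: "card (cl x) \<le> 3" if "x \<in> N" for x
  proof -
    have "card (insert v (cl x)) \<le> 4"
    proof (rule clique_card_le_4)
      show "insert v (cl x) \<subseteq> V" using cl_sub N(1) by blast
      show "E y z" if "y \<in> insert v (cl x)" "z \<in> insert v (cl x)" "y \<noteq> z" for y z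
        using that cl_clique[OF \<open>x \<in> N\<close>] vN cl_sub by blast
    qed
    moreover have "v \<notin> cl x" using cl_sub N(2) by blast
    ultimately show ?thesis using cl_sub by simp
  qed
  define B where "B = {C \<in> cl ` N. card C = 3}"
  have finB: "finite B" using N(3) by (simp add: B_def)
  have "card B \<le> 2"
  proof (rule ccontr)
    assume "\<not> card B \<le> 2"
    then obtain B' where B': "B' \<subseteq> B" "card B' = 3" by (metis obtain_subset_with_card_n not_less_eq_eq numeral_2_eq_2 numeral_3_eq_3)
    then obtain C1 C2 C3 where "B' = {C1, C2, C3}" and ne: "C1 \<noteq> C2" "C1 \<noteq> C3" "C2 \<noteq> C3"
      unfolding card_3_iff by blast
    then have C: "C1 \<in> B" "C2 \<in> B" "C3 \<in> B" using B'(1) by auto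
    have sep: "x \<notin> D \<and> y \<notin> C \<and> \<not> E x y" if "C \<in> B" "D \<in> B" "C \<noteq> D" "x \<in> C" "y \<in> D" for C D x y
    proof -
      have "C \<in> cl ` N" "D \<in> cl ` N" using that by (auto simp: B_def)
      then obtain c d where cd: "c \<in> N" "C = cl c" "d \<in> N" "D = cl d" by blast
      then have "x \<in> N" "y \<in> N" "cl x = C" "cl y = D" using that fib[of c] fib[of d] by blast+
      then have "\<not> E x y" "x \<noteq> y" using cl_eq[of x y] that by auto
      moreover have "x \<notin> D" "y \<notin> C"
        using \<open>cl x = C\<close> \<open>cl y = D\<close> \<open>C \<noteq> D\<close> fib[of c] fib[of d] cd by blast+
      ultimately show ?thesis by blast
    qed
    have "embeds graph_H0 V E"
    proof (rule embeds_H0I[of v C1 C2 C3 V E, OF _ symp_E irreflp_E])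
      show "insert v (C1 \<union> C2 \<union> C3) \<subseteq> V" using C cl_sub N(1) by (auto simp: B_def)
      show "card C1 = 3" "card C2 = 3" "card C3 = 3" using C by (auto simp: B_def)
      show "C1 \<inter> C2 = {}" "C1 \<inter> C3 = {}" "C2 \<inter> C3 = {}" using sep C ne by blast+
      show "\<forall>x\<in>C1 \<union> C2 \<union> C3. E v x" using C cl_sub vN by (auto simp: B_def)
      show "E x y" if "K \<in> {C1, C2, C3}" "x \<in> K" "y \<in> K" "x \<noteq> y" for K x y
      proof -
        have "K \<in> B" using that(1) C by blast
        then obtain c where "c \<in> N" "K = cl c" by (auto simp: B_def)
        then show ?thesis using cl_clique that by blast
      qed
      show "\<not> E x y" if "x \<in> C1" "y \<in> C2" for x y using sep[OF C(1,2) ne(1)] that by blast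
      show "\<not> E x y" if "x \<in> C1" "y \<in> C3" for x y using sep[OF C(1,3) ne(2)] that by blast
      show "\<not> E x y" if "x \<in> C2" "y \<in> C3" for x y using sep[OF C(2,3) ne(3)] that by blast
    qed
    then show False using free by blast
  qed
  then obtain B1 B2 where B12: "B \<subseteq> {B1, B2}"
  proof -
    consider "card B = 0" | "card B = 1" | "card B = 2" using \<open>card B \<le> 2\<close> by linarith
    then show thesis
    proof cases
      case 1 then show thesis using finB that[of "{}" "{}"] by simp
    next
      case 2 then show thesis using that by (metis card_1_singletonE insertI1 subset_insertI)
    next
      case 3 then show thesis using that by (metis card_2_iff order_refl)
    qed
  qed
  obtain e :: "'a set \<Rightarrow> nat" where e: "inj_on e (cl ` N)" "e ` cl ` N \<subseteq> {..<card (cl ` N)}"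
    using card_le_inj[of "cl ` N" "{..<card (cl ` N)}"] N(3) by auto
  define M where "M = int (card (cl ` N)) + 1"
  \<comment> \<open>\<open>B1\<close> and \<open>B2\<close>, which include every class of size
    three, go to the ends 0 and \<open>M\<close>; the remaining classes get distinct columns
    strictly between, for which \<open>M\<close> leaves room.\<close>
  define pos where "pos C = (if C = B1 then 0 else if C = B2 then M else int (e C) + 1)" for C
  have eC: "int (e C) + 1 < M" if "C \<in> cl ` N" for C
  proof -
    have "e C < card (cl ` N)" using e(2) that by blast
    then show ?thesis by (simp add: M_def)
  qed
  have M: "0 < M" by (simp add: M_def)
  have pos_inj: "pos C = pos D \<longleftrightarrow> C = D" if "C \<in> cl ` N" "D \<in> cl ` N" for C D
    using eC[OF that(1)] eC[OF that(2)] M inj_onD[OF e(1) _ that] unfolding pos_def by auto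
  obtain j :: "'a \<Rightarrow> nat" where j: "\<And>s. s \<in> N \<Longrightarrow> j s < card {t\<in>N. cl t = cl s}"
    and j_inj: "\<And>s t. s \<in> N \<Longrightarrow> t \<in> N \<Longrightarrow> cl s = cl t \<Longrightarrow> j s = j t \<Longrightarrow> s = t"
    using fibre_colouring[OF N(3), of cl] by blast
  show ?thesis
  proof (rule rep_windmill[OF N(1,2) symp_E M, of "\<lambda>x. pos (cl x)" j])
    show "E v x" if "x \<in> N" for x using vN that by blast
    show "0 \<le> pos (cl x) \<and> pos (cl x) \<le> M" if "x \<in> N" for x
      using eC[of "cl x"] that M by (auto simp: pos_def)
    show "j x < 3" if "x \<in> N" for x
      using j[OF that] card_cl[OF that] unfolding fib[OF that] by linarith
    show "pos (cl x) = 0 \<or> pos (cl x) = M" if "x \<in> N" "j x = 2" for x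
    proof -
      have "card (cl x) = 3" using j[OF that(1)] card_cl[OF that(1)] that(2) unfolding fib[OF that(1)] by linarith
      then have "cl x \<in> B" using that(1) by (simp add: B_def)
      then show ?thesis using B12 by (auto simp: pos_def)
    qed
    show "E x y \<longleftrightarrow> pos (cl x) = pos (cl y)" if "x \<in> N" "y \<in> N" "x \<noteq> y" for x y
      using pos_inj[of "cl x" "cl y"] cl_eq[of x y] that by auto
    show "x = y" if "x \<in> N" "y \<in> N" "pos (cl x) = pos (cl y)" "j x = j y" for x y
      using pos_inj[of "cl x" "cl y"] j_inj that by auto
  qed
qed

text \<open>The common neighbours of the two opposite pairs of the square form the sides
  \<open>X\<close> and \<open>Y\<close> of a complete bipartite graph. As \<open>K33\<close> is
  excluded, one side has only two vertices and a ladder represents the graph.\<close>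

lemma rep_if_square:
  assumes no_P4: "\<And>a b c d. \<not> P4 V E a b c d"
    and V: "v \<in> V" "w \<in> V" "u \<in> V" "x \<in> V"
    and sq: "E v w" "E w u" "E u x" "E x v" "\<not> E v u" "\<not> E w x" "v \<noteq> u" "w \<noteq> x"
  shows "\<exists>P. contact_rep V E P"
proof -
  have sq': "E w v" "E u w" "E x u" "E v x" "\<not> E u v" "\<not> E x w" using sq adj_sym by blast+
  define X where "X = {y \<in> V. E y v \<and> E y u}"
  define Y where "Y = {y \<in> V. E y w \<and> E y x}"
  have mem: "w \<in> X" "x \<in> X" "v \<in> Y" "u \<in> Y" using V sq sq' by (auto simp: X_def Y_def)
  have sub: "X \<subseteq> V" "Y \<subseteq> V" by (auto simp: X_def Y_def)
  have disj: "X \<inter> Y = {}"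
  proof (rule ccontr)
    assume "X \<inter> Y \<noteq> {}"
    then obtain y where "y \<in> V" "E y v" "E y u" "E y w" by (auto simp: X_def Y_def)
    then show False using diamond[of y w v u] V sq sq' by blast
  qed
  have indX: "\<not> E y z" if "y \<in> X" "z \<in> X" for y z
    using diamond[of y z v u] that V sq sq' by (auto simp: X_def)
  have indY: "\<not> E y z" if "y \<in> Y" "z \<in> Y" for y z
    using diamond[of y z w x] that V sq sq' by (auto simp: Y_def)
  \<comment> \<open>A missing edge \<open>y z\<close> would leave the induced path
    \<open>y v w z\<close>.\<close>
  have compl: "E y z" if "y \<in> X" "z \<in> Y" for y z
  proof (rule ccontr)
    assume "\<not> E y z"
    moreover have "E y v" "E w z" "\<not> E y w" "\<not> E v z"
      using that indX[of y w] indY[of v z] mem adj_sym by (auto simp: X_def Y_def)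
    ultimately show False using no_P4[of y v w z] P4I[of y v w z] that sub V sq by blast
  qed
  \<comment> \<open>A vertex \<open>z\<close> outside both sides misses some \<open>w'\<close> in
    \<open>X\<close> and some \<open>v'\<close> in \<open>Y\<close>, so a neighbour \<open>s\<close>
    of \<open>z\<close> gives the induced path \<open>z s v' w'\<close> or
    \<open>z s w' v'\<close>.\<close>
  have VXY: "V = X \<union> Y"
  proof (rule eq_if_no_outer_edge)
    fix s z assume s: "s \<in> X \<union> Y" and z: "z \<in> V" "z \<notin> X \<union> Y" "E z s"
    show False
    proof (cases "s \<in> X")
      case True
      obtain w' where w': "w' \<in> X" "\<not> E z w'" using z mem by (auto simp: Y_def)
      obtain v' where v': "v' \<in> Y" "\<not> E z v'" using z mem by (auto simp: X_def)
      have "P4 V E z s v' w'"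
        using P4I[of z s v' w'] True w' v' z sub compl indX adj_sym by blast
      then show False using no_P4 by blast
    next
      case False
      then have sY: "s \<in> Y" using s by blast
      obtain w' where w': "w' \<in> X" "\<not> E z w'" using z mem by (auto simp: Y_def)
      obtain v' where v': "v' \<in> Y" "\<not> E z v'" using z mem by (auto simp: X_def)
      have "P4 V E z s w' v'"
        using P4I[of z s w' v'] sY w' v' z sub compl indY adj_sym by blast
      then show False using no_P4 by blast
    qed
  qed (use sub mem in auto)
  have fin: "finite X" "finite Y" using sub finite_V finite_subset by blast+
  have compl': "E z y" if "y \<in> X" "z \<in> Y" for y z using compl that adj_sym by blast
  have "embeds graph_K33 V E" if "card X \<ge> 3" "card Y \<ge> 3"
    by (rule embeds_K33I[OF sub(1) fin(1) that(1) sub(2) fin(2) that(2) disj])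
      (simp_all add: indX indY compl compl')
  then consider "card X \<le> 2" | "card Y \<le> 2" using free[of graph_K33] by fastforce
  then show ?thesis
  proof cases
    case 1
    have X: "X = {w, x}"
      using card_seteq[of X "{w, x}"] fin mem 1 sq(8) by auto
    show ?thesis
      by (rule rep_K2n[of V w x Y E, OF _ sq(8) _ fin(2) symp_E sq(6)])
        (use VXY disj X compl indY in auto)
  next
    case 2
    have Y: "Y = {v, u}"
      using card_seteq[of Y "{v, u}"] fin mem 2 sq(7) by auto
    show ?thesis
      by (rule rep_K2n[of V v u X E, OF _ sq(7) _ fin(1) symp_E sq(5)])
        (use VXY disj Y compl' indX in auto)
  qed
qed

lemma rep_if_no_P4:
  assumes no_P4: "\<And>a b c d. \<not> P4 V E a b c d" and "V \<noteq> {}"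
  shows "\<exists>P. contact_rep V E P"
proof -
  define N where "N v = {u \<in> V. E v u}" for v
  have finN: "finite (N v)" for v using finite_V by (simp add: N_def)
  obtain v where v: "v \<in> V" "\<And>w. w \<in> V \<Longrightarrow> card (N w) \<le> card (N v)"
  proof -
    have "Max ((\<lambda>w. card (N w)) ` V) \<in> (\<lambda>w. card (N w)) ` V"
      using finite_V assms(2) by (intro Max_in) auto
    then obtain v where "v \<in> V" "card (N v) = Max ((\<lambda>w. card (N w)) ` V)" by auto
    then show thesis using that[of v] finite_V by (simp add: Max_ge)
  qed
  show ?thesis
  proof (cases "V = insert v (N v)")
    case True
    then show ?thesis using rep_if_dominating[OF v(1)] by (auto simp: N_def)
  next
    case False
    have "\<exists>w u. w \<in> insert v (N v) \<and> u \<in> V \<and> u \<notin> insert v (N v) \<and> E u w"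
      using eq_if_no_outer_edge[of "insert v (N v)"] False v(1) unfolding N_def by blast
    then obtain w u where wu: "w \<in> insert v (N v)" "u \<in> V" "u \<notin> insert v (N v)" "E u w" by blast
    then have w: "w \<in> V" "E v w" "\<not> E v u" "u \<noteq> v" "E w u" "E w v" using adj_sym by (auto simp: N_def)
    \<comment> \<open>Otherwise \<open>w\<close> is adjacent to \<open>v\<close>, to
      \<open>u\<close> and to all of \<open>N v\<close> but itself, and its degree exceeds the
      maximal degree, that of \<open>v\<close>.\<close>
    have "\<exists>x\<in>N v. x \<noteq> w \<and> \<not> E w x"
    proof (rule ccontr)
      assume "\<not> ?thesis"
      then have "insert v (insert u (N v - {w})) \<subseteq> N w" using w wu v(1) by (auto simp: N_def)
      then have "card (insert v (insert u (N v - {w}))) \<le> card (N w)" using finN card_mono by blast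
      moreover have "card (insert v (insert u (N v - {w}))) = Suc (Suc (card (N v - {w})))"
        using w finN by (simp add: N_def)
      moreover have "Suc (card (N v - {w})) = card (N v)"
        using finN w by (intro card_Suc_Diff1) (auto simp: N_def)
      ultimately show False using v(2)[OF w(1)] by linarith
    qed
    then obtain x where x: "x \<in> V" "E v x" "x \<noteq> w" "\<not> E w x" by (auto simp: N_def)
    have "E u x"
    proof (rule ccontr)
      assume "\<not> E u x"
      then have "P4 V E u w v x" using P4I[of u w v x] w wu x v(1) adj_sym by blast
      then show False using no_P4 by blast
    qed
    then show ?thesis
      using rep_if_square[OF no_P4 v(1) w(1) wu(2) x(1)] w x adj_sym by blast
  qed
qed

end

section \<open>Reduction to connected graphs, and the equivalence\<close>

context tidy_free_graph
begin

text \<open>Induced paths, partners and embeddings inside \<open>W\<close> are also such inside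
  \<open>V\<close>.\<close>

lemma tidy_free_graph_subset:
  assumes "W \<subseteq> V"
  shows "tidy_free_graph W E"
proof
  show "finite W" using assms finite_V finite_subset by blast
  have P4: "P4 V E a b c d" if "P4 W E a b c d" for a b c d
    using that assms unfolding P4_def by blast
  have P4_partner: "P4_partner V E A v" if p: "P4_partner W E A v" for A v
  proof -
    obtain x y z where v: "v \<notin> A" "{x, y, z} \<subseteq> A" and "P4 W E v x y z \<or> P4 W E x v y z"
      using p unfolding P4_partner_def by blast
    then have "P4 V E v x y z \<or> P4 V E x v y z" using P4 by blast
    then show ?thesis unfolding P4_partner_def using v by (intro conjI exI[of _ x] exI[of _ y] exI[of _ z])
  qed
  show "v = w" if "P4 W E a b c d" "P4_partner W E {a, b, c, d} v" "P4_partner W E {a, b, c, d} w" for a b c d v w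
    by (rule tidy[OF P4[OF that(1)] P4_partner[OF that(2)] P4_partner[OF that(3)]])
  show "\<not> embeds H W E" if "H \<in> {graph_K5, graph_K33, graph_H0, graph_K4_minus}" for H
    using free[OF that] assms unfolding embeds_def by (meson subset_trans)
qed (rule symp_E irreflp_E)+

end

text \<open>If some cut of \<open>V\<close> has no edge across it, both parts are smaller and their
  representations are put side by side; otherwise the graph is connected.\<close>

lemma rep_if_tidy_free_graph:
  assumes "tidy_free_graph V E"
  shows "\<exists>P. contact_rep V E P"
  using assms
proof (induction "card V" arbitrary: V rule: less_induct)
  case less
  interpret tidy_free_graph V E by (rule less.prems)
  show ?case
  proof (cases "\<forall>S. S \<subset> V \<longrightarrow> S \<noteq> {} \<longrightarrow> (\<exists>x\<in>S. \<exists>y\<in>V - S. E x y)")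
    case True
    interpret connected_tidy_free_graph V E by unfold_locales (use True in blast)
    show ?thesis
    proof (cases "V = {}")
      case False
      then show ?thesis using rep_if_P4 rep_if_no_P4 by blast
    next
      case True
      then show ?thesis by (intro exI[of _ undefined]) (simp add: contact_rep_def)
    qed
  next
    case False
    then obtain S where S: "S \<subset> V" "S \<noteq> {}" "\<And>x y. x \<in> S \<Longrightarrow> y \<in> V - S \<Longrightarrow> \<not> E x y" by blast
    have "card S < card V" "card (V - S) < card V"
      using S finite_V by (auto intro!: psubset_card_mono)
    then obtain P Q where "contact_rep S E P" "contact_rep (V - S) E Q"
      using less.hyps tidy_free_graph_subset S by (metis Diff_subset psubset_imp_subset)
    then have "\<exists>R. contact_rep (S \<union> (V - S)) E R"
      using S adj_sym finite_V finite_subset[of S V] by (intro rep_union) auto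
    then show ?thesis using S by (simp add: Un_absorb1 psubset_imp_subset)
  qed
qed

lemma parcs_subset:
  assumes "pair_graph H"
  shows "parcs H \<subseteq> pverts H \<times> pverts H"
proof -
  interpret pair_graph H by fact
  show ?thesis using arc_fst_in_verts arc_snd_in_verts by fastforce
qed

theorem theorem22:
  fixes G :: "('a, 'b) pre_digraph"
  assumes "graph G" and "P4_tidy G"
  shows "contact_B0_VPG G \<longleftrightarrow> free_of {graph_K5, graph_K33, graph_H0, graph_K4_minus} G"
proof -
  interpret graph G by fact
  let ?\<H> = "{graph_K5, graph_K33, graph_H0, graph_K4_minus}"
  let ?E = "\<lambda>u v. u \<rightarrow>\<^bsub>G\<^esub> v"
  have "parcs graph_K5 \<subseteq> pverts graph_K5 \<times> pverts graph_K5"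
    by (auto simp: graph_K5_def complete_on_def)
  moreover have "parcs graph_K33 \<subseteq> pverts graph_K33 \<times> pverts graph_K33"
    unfolding graph_K33_def pair_pre_digraph.simps by blast
  ultimately have "parcs H \<subseteq> pverts H \<times> pverts H" if "H \<in> ?\<H>" for H
    using that parcs_subset pair_graph_graph_K4_minus pair_graph_graph_H0 by blast
  then have free: "free_of ?\<H> G \<longleftrightarrow> (\<forall>H\<in>?\<H>. \<not> embeds H (verts G) ?E)"
    by (rule free_of_iff_not_embeds[OF assms(1)])
  have rep: "contact_B0_VPG G \<longleftrightarrow> (\<exists>P. contact_rep (verts G) ?E P)"
    by (simp add: contact_B0_VPG_def contact_B0_VPG_representation_iff_contact_rep)
  show ?thesis
  proof
    assume "contact_B0_VPG G"
    then show "free_of ?\<H> G" unfolding rep free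
      using rep_not_embeds_K5 rep_not_embeds_K33 rep_not_embeds_H0 rep_not_embeds_K4_minus by blast
  next
    assume "free_of ?\<H> G"
    then have *: "\<not> embeds H (verts G) ?E" if "H \<in> ?\<H>" for H using that unfolding free by blast
    have "tidy_free_graph (verts G) ?E"
    proof
      show "symp ?E" using sym_arcs by (auto simp: symmetric_def sym_def symp_def)
      show "irreflp ?E" using adj_not_same by (auto simp: irreflp_def)
      \<comment> \<open>Tidiness of \<open>G\<close> is stated with \<open>partner\<close>; every
        \<open>P4_partner\<close> of an induced path is one.\<close>
      show "v = w" if "P4 (verts G) ?E a b c d" "P4_partner (verts G) ?E {a, b, c, d} v"
        "P4_partner (verts G) ?E {a, b, c, d} w" for a b c d v w
        using assms(2) induces_P4I[OF assms(1) that(1)] partner_if_P4_partner[OF assms(1) that(1)] that(2,3)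
        unfolding P4_tidy_def by blast
    qed (use * in auto)
    then show "contact_B0_VPG G" unfolding rep by (rule rep_if_tidy_free_graph)
  qed
qed

end
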